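(* Let $d\ge 1$ and let $g=\frac{(d-1)(d-2)}{2}$. For every integer $d'\ge 0$ with $d'\equiv d \pmod 3$, $d'\le d$, let $q_{d'}$ be the homogeneous polynomial in $z=(z_1,z_2,z_3)$ described in the context (with $q_0:=1$), where the positive numbers $t_{d',1},\dots,t_{d',d'}$ are pairwise distinct, satisfy $t_{d',d'-i+1}=1/t_{d',i}$, and for every such $d'\ge 3$ the sets $\{t_{d',i}\}_i$ and $\{t_{d'-3,j}\}_j$ are disjoint. Define recursively $p_0:=1$, $p_1:=q_1$, $p_2:=q_2$ and, for $d'\ge 3$, $$p_{d'}(z)=q_{d'}(z)+b_{d'}\,z_1z_2z_3\,p_{d'-3}(z),\qquad b_{d'}>0,$$ so that $p_d=\sum_{k=0}^{[d/3]}c_k\,q_{d-3k}(z)\,(z_1z_2z_3)^k$ with $c_0=1$, $c_k=b_db_{d-3}\cdots b_{d-3k+3}$. Then for each $d'\ge 3$ there is a threshold $B_{d'}>0$, depending only on the numbers $t_{\cdot,\cdot}$ and on $b_{d'-3},b_{d'-6},\dots$, such that if $b_{d'}>B_{d'}$ for every $d'\equiv d\pmod 3$ with $3\le d'\le d$, then $F(C_{p_d})$ has exactly $g$ holes, and $F(C_{p_d})$ meets each edge of the triangle $\Delta_2$ in exactly $d$ points.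
   Context: $\mathbb{CP}^2$ has homogeneous coordinates $[z_1,z_2,z_3]$. $F:\mathbb{CP}^2\to\Delta_2=\{r\in\mathbb{R}^3_{\ge0}: r_1+r_2+r_3=1\}$ is the moment map of the Fubini–Study form, $F([z])=(|z_1|^2,|z_2|^2,|z_3|^2)/(|z_1|^2+|z_2|^2+|z_3|^2)$. For a homogeneous polynomial $p$, $C_p=\{p=0\}\subset\mathbb{CP}^2$. A "hole" of $F(C_p)$ is a connected component of $\Delta_2\setminus F(C_p)$ whose closure is disjoint from $\partial\Delta_2$. For $d'\ge1$ define the binary form $q_{d'}(z_1,z_2)=\prod_{i=1}^{d'}(z_1+t_{d',i}z_2)=\sum_{i=0}^{d'}\beta_i z_1^{d'-i}z_2^i$ (so $\beta_0=\beta_{d'}=1$ and $\beta_{d'-i}=\beta_i$), and define the ternary form $q_{d'}(z_1,z_2,z_3)=\sum_I a_I z^I$, summing over $I=(i_1,i_2,i_3)\in\mathbb{Z}^3_{\ge0}$, $|I|=d'$, lying on the boundary of the Newton triangle (some $i_j=0$), with $a_{(d'-i,i,0)}=a_{(0,d'-i,i)}=a_{(i,0,d'-i)}=\beta_i$; coefficients at interior lattice points are $0$. $q_0:=1$. *)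

theory Defs
  imports "HOL-Analysis.Analysis" "HOL-Computational_Algebra.Polynomial"
begin

text \<open>Coefficients of the binary form
  q(z1,z2) = prod_{j=1..n} (z1 + t n j * z2) = sum_i beta_i z1^(n-i) z2^i.
  Dehomogenising at z1 = 1 gives prod_j (1 + t n j * y) = sum_i beta_i y^i.\<close>
definition beta :: "(nat \<Rightarrow> nat \<Rightarrow> real) \<Rightarrow> nat \<Rightarrow> nat \<Rightarrow> real" where
  "beta t n i = coeff (\<Prod>j\<in>{1..n}. [:1, t n j:]) i"

definition bdry_exps :: "nat \<Rightarrow> (nat \<times> nat \<times> nat) set" where
  "bdry_exps n = {(i1, i2, i3). i1 + i2 + i3 = n \<and> (i1 = 0 \<or> i2 = 0 \<or> i3 = 0)}"

definition qcoef :: "(nat \<Rightarrow> nat \<Rightarrow> real) \<Rightarrow> nat \<Rightarrow> nat \<times> nat \<times> nat \<Rightarrow> real" where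
  "qcoef t n I = (case I of (i1, i2, i3) \<Rightarrow>
      if i3 = 0 then beta t n i2 else if i1 = 0 then beta t n i3 else beta t n i1)"

definition qpoly :: "(nat \<Rightarrow> nat \<Rightarrow> real) \<Rightarrow> nat \<Rightarrow> complex^3 \<Rightarrow> complex" where
  "qpoly t n z = (if n = 0 then 1 else
     (\<Sum>(i1, i2, i3)\<in>bdry_exps n. complex_of_real (qcoef t n (i1, i2, i3)) *
         z$1 ^ i1 * z$2 ^ i2 * z$3 ^ i3))"

fun ppoly :: "(nat \<Rightarrow> nat \<Rightarrow> real) \<Rightarrow> (nat \<Rightarrow> real) \<Rightarrow> nat \<Rightarrow> complex^3 \<Rightarrow> complex" where
  "ppoly t b 0 z = 1"
| "ppoly t b (Suc 0) z = qpoly t 1 z"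
| "ppoly t b (Suc (Suc 0)) z = qpoly t 2 z"
| "ppoly t b (Suc (Suc (Suc n))) z =
     qpoly t (n + 3) z + complex_of_real (b (n + 3)) * z$1 * z$2 * z$3 * ppoly t b n z"

text \<open>Moment map of Fubini--Study, on nonzero representatives of CP^2.\<close>
definition momentF :: "complex^3 \<Rightarrow> real^3" where
  "momentF z = (\<chi> i. (cmod (z$i))\<^sup>2 / (\<Sum>j\<in>UNIV. (cmod (z$j))\<^sup>2))"

definition simplex2 :: "(real^3) set" where
  "simplex2 = {r. (\<forall>i. r$i \<ge> 0) \<and> r$1 + r$2 + r$3 = 1}"

definition simplex2_bdry :: "(real^3) set" where
  "simplex2_bdry = {r \<in> simplex2. \<exists>i. r$i = 0}"

definition simplex2_edge :: "3 \<Rightarrow> (real^3) set" where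
  "simplex2_edge k = {r \<in> simplex2. r$k = 0}"

text \<open>The curve C_p, as the set of nonzero representatives in C^3.\<close>
definition curve :: "(complex^3 \<Rightarrow> complex) \<Rightarrow> (complex^3) set" where
  "curve p = {z. z \<noteq> 0 \<and> p z = 0}"

definition holes :: "(real^3) set \<Rightarrow> (real^3) set set" where
  "holes S = {U \<in> components (simplex2 - S). closure U \<inter> simplex2_bdry = {}}"

end

theory Submission
  imports Defs "HOL-Computational_Algebra.Fundamental_Theorem_Algebra"
begin

text \<open>The complement of the amoeba of a form \<open>p\<close> is studied through the order of a torus on which
  \<open>p\<close> has no zeros: the vector of increments of \<open>log p\<close> along the coordinate circles. Restricting \<open>p\<close>
  to monomial curves turns increments into numbers of zeros of one-variable polynomials. Hence tori
  of equal order lie in one component of the complement, an order with a zero component lets the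
  torus shrink to an edge of the triangle, and the components whose order is positive in all three
  entries stay away from the boundary. So the holes correspond to the positive orders of sum \<open>d\<close>
  that occur. All of them occur by induction: orders with a zero entry are visible on an edge, where
  \<open>p\<close> splits into linear factors with distinct moduli of roots, and the remaining ones are those of
  \<open>p\<^sub>d\<^sub>-\<^sub>3\<close> shifted by \<open>(1,1,1)\<close>, by domination for large \<open>b\<^sub>d\<close>.\<close>

text \<open>The order is the Forsberg-Passare-Tsikh order of a component of an amoeba complement.
  That it separates components is usually derived from their convexity, hence from complex analysis
  in several variables. Here factorisation of one-variable polynomials and a Rouche argument for
  continuous logarithms suffice. The price is that a monomial curve moves only in directions with
  natural exponents, so two tori of equal order are joined by such a curve only up to a small error.
  The other obstacle is the boundary: the amoeba meets the edges, so a component might accumulate at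
  an edge point where no order exists. Positivity of the numbers \<open>t\<close> helps: on a
  boundary torus \<open>p\<close> is nonzero at the point with all angles zero, and a single
  zero-free disc near that point already decides one entry of the order. The number g counts the
  interior lattice points of the triangle of size \<open>d\<close>. Shifted by (-1,-1,-1) they are
  all lattice points, boundary included, of the triangle of size \<open>d - 3\<close>;
  multiplication by \<open>z\<^sub>1z\<^sub>2z\<^sub>3\<close> reverses this shift on orders. This
  is why the recursion goes in steps of three.\<close>

section \<open>Continuous logarithms and winding numbers\<close>

text \<open>The increments of a continuous logarithm of \<open>f\<close> along the periods \<open>v\<close> of \<open>f\<close>, in units of \<open>2\<pi>i\<close>;
  on a torus they are the winding numbers along the coordinate circles.\<close>

definition log_lift :: "('a::real_normed_vector \<Rightarrow> complex) \<Rightarrow> ('i \<Rightarrow> 'a) \<Rightarrow> ('i \<Rightarrow> int) \<Rightarrow> bool" where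
  "log_lift f v n \<longleftrightarrow> (\<exists>L. continuous_on UNIV L \<and> (\<forall>x. f x = exp (L x)) \<and>
     (\<forall>x j. L (x + v j) = L x + of_real (2 * pi * of_int (n j)) * \<i>))"

lemma log_liftI:
  assumes "continuous_on UNIV L" "\<And>x. f x = exp (L x)"
    "\<And>x j. L (x + v j) = L x + of_real (2 * pi * of_int (n j)) * \<i>"
  shows "log_lift f v n"
  using assms unfolding log_lift_def by blast

lemma log_lift_nonzero: "log_lift f v n \<Longrightarrow> f x \<noteq> 0"
  unfolding log_lift_def by auto

text \<open>Distinct points of 2\<pi>iZ are at least 2\<pi> apart, and the domain is
  connected.\<close>

lemma exp_const_imp_const:
  fixes f :: "'a::real_normed_vector \<Rightarrow> complex"
  assumes "continuous_on UNIV f" "\<And>x. exp (f x) = 1"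
  shows "f x = f y"
proof -
  have "f constant_on UNIV"
  proof (rule continuous_discrete_range_constant[OF connected_UNIV assms(1)])
    fix x
    have "2 * pi \<le> norm (f y - f x)" if "f y \<noteq> f x" for y
    proof -
      have "exp (f y - f x) = 1" using assms(2) by (simp add: exp_diff)
      then obtain n :: int where n: "Re (f y - f x) = 0" "Im (f y - f x) = of_int (2 * n) * pi"
        unfolding exp_eq_1 by blast
      then have "n \<noteq> 0" using that by (auto simp: complex_eq_iff)
      then have "1 \<le> \<bar>real_of_int n\<bar>" by linarith
      then have "2 * pi * 1 \<le> 2 * pi * \<bar>real_of_int n\<bar>" by (intro mult_left_mono) auto
      also have "\<dots> = \<bar>Im (f y - f x)\<bar>" unfolding n by (simp add: abs_mult)
      also have "\<dots> \<le> norm (f y - f x)" by (rule abs_Im_le_cmod)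
      finally show ?thesis by simp
    qed
    then show "\<exists>e>0. \<forall>y. y \<in> UNIV \<and> f y \<noteq> f x \<longrightarrow> e \<le> norm (f y - f x)"
      by (intro exI[of _ "2 * pi"]) auto
  qed
  then show ?thesis unfolding constant_on_def by auto
qed

text \<open>Two continuous logarithms of \<open>f\<close> differ by a constant, which cancels in
  every increment.\<close>

lemma log_lift_unique:
  assumes "log_lift f v n" "log_lift f v n'"
  shows "n = n'"
proof
  fix j
  obtain L where L: "continuous_on UNIV L" "\<And>x. f x = exp (L x)"
    "\<And>x j. L (x + v j) = L x + of_real (2 * pi * of_int (n j)) * \<i>"
    using assms(1) unfolding log_lift_def by blast
  obtain L' where L': "continuous_on UNIV L'" "\<And>x. f x = exp (L' x)"
    "\<And>x j. L' (x + v j) = L' x + of_real (2 * pi * of_int (n' j)) * \<i>"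
    using assms(2) unfolding log_lift_def by blast
  have "exp (L x - L' x) = 1" for x using L(2) L'(2) by (simp add: exp_diff)
  then have "L (0 + v j) - L' (0 + v j) = L 0 - L' 0"
    by (intro exp_const_imp_const[of "\<lambda>x. L x - L' x"] continuous_intros L L')
  then have "of_real (2 * pi * of_int (n j)) * \<i> = of_real (2 * pi * of_int (n' j)) * \<i>"
    unfolding L(3) L'(3) by simp
  then show "n j = n' j" by (simp add: complex_eq_iff)
qed

text \<open>The domain is contractible, so a global logarithm exists. Its increment over a period is
  a logarithm of 1 that varies continuously with the base point, hence a constant.\<close>

lemma log_lift_exists:
  assumes "continuous_on UNIV f" "\<And>x. f x \<noteq> 0" "\<And>x j. f (x + v j) = f x"
  shows "\<exists>n. log_lift f v n"
proof -
  obtain L where L: "continuous_on UNIV L" "\<And>x. f x = exp (L x)"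
    using continuous_logarithm_on_contractible[OF assms(1) contractible_UNIV] assms(2) by auto
  have "\<exists>k::int. \<forall>x. L (x + v j) = L x + of_real (2 * pi * of_int k) * \<i>" for j
  proof -
    have e: "exp (L (x + v j) - L x) = 1" for x
      using assms(2)[of x] assms(3)[of x j] L(2) by (simp add: exp_diff)
    have c: "L (x + v j) - L x = L (0 + v j) - L 0" for x
      by (intro exp_const_imp_const[of "\<lambda>x. L (x + v j) - L x"] e continuous_intros L(1)
          continuous_on_compose2[OF L(1)]) auto
    obtain k :: int where "Re (L (0 + v j) - L 0) = 0" "Im (L (0 + v j) - L 0) = of_int (2 * k) * pi"
      using e[of 0] unfolding exp_eq_1 by blast
    then have "L (0 + v j) - L 0 = of_real (2 * pi * of_int k) * \<i>"
      by (auto simp: complex_eq_iff)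
    then have "L (x + v j) = L x + of_real (2 * pi * of_int k) * \<i>" for x
      using c[of x] by (simp add: algebra_simps)
    then show ?thesis by blast
  qed
  then obtain n where "\<And>j x. L (x + v j) = L x + of_real (2 * pi * of_int (n j)) * \<i>"
    by metis
  then show ?thesis using log_liftI[OF L] by blast
qed

lemma log_lift_const: "c \<noteq> 0 \<Longrightarrow> log_lift (\<lambda>_. c) v (\<lambda>_. 0)"
  by (rule log_liftI[of "\<lambda>_. Ln c"]) (auto simp: exp_Ln)

lemma log_lift_mult:
  assumes "log_lift f v n" "log_lift g v m"
  shows "log_lift (\<lambda>x. f x * g x) v (\<lambda>j. n j + m j)"
proof -
  obtain L where L: "continuous_on UNIV L" "\<And>x. f x = exp (L x)"
    "\<And>x j. L (x + v j) = L x + of_real (2 * pi * of_int (n j)) * \<i>"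
    using assms(1) unfolding log_lift_def by blast
  obtain L' where L': "continuous_on UNIV L'" "\<And>x. g x = exp (L' x)"
    "\<And>x j. L' (x + v j) = L' x + of_real (2 * pi * of_int (m j)) * \<i>"
    using assms(2) unfolding log_lift_def by blast
  show ?thesis
    by (rule log_liftI[of "\<lambda>x. L x + L' x"])
      (auto intro!: continuous_intros L L' simp: L L' exp_add algebra_simps)
qed

lemma log_lift_prod:
  assumes "finite A" "\<And>i. i \<in> A \<Longrightarrow> log_lift (f i) v (n i)"
  shows "log_lift (\<lambda>x. \<Prod>i\<in>A. f i x) v (\<lambda>j. \<Sum>i\<in>A. n i j)"
  using assms
  by (induction A rule: finite_induct) (auto intro: log_lift_const log_lift_mult)

text \<open>The quotient \<open>g/f\<close> stays in the open unit disc around 1, where the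
  principal branch \<open>Ln\<close> is continuous. Adding \<open>Ln (g/f)\<close> to a logarithm of
  \<open>f\<close> gives one of \<open>g\<close>, with the same increments because the quotient is
  periodic.\<close>

lemma log_lift_rouche:
  assumes "log_lift f v n" "continuous_on UNIV f" "continuous_on UNIV g"
    "\<And>x. cmod (g x - f x) < cmod (f x)" "\<And>x j. g (x + v j) = g x"
  shows "log_lift g v n"
proof -
  obtain L where L: "continuous_on UNIV L" "\<And>x. f x = exp (L x)"
    "\<And>x j. L (x + v j) = L x + of_real (2 * pi * of_int (n j)) * \<i>"
    using assms(1) unfolding log_lift_def by blast
  have f0: "f x \<noteq> 0" for x using L by simp
  have q: "g x / f x \<notin> \<real>\<^sub>\<le>\<^sub>0" for x
  proof -
    have "g x / f x - 1 = (g x - f x) / f x" using f0[of x] by (simp add: diff_divide_distrib)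
    then have "cmod (g x / f x - 1) < 1"
      using assms(4)[of x] f0[of x] by (simp only: norm_divide) simp
    then have "\<bar>Re (g x / f x - 1)\<bar> < 1" using abs_Re_le_cmod[of "g x / f x - 1"] by linarith
    then show ?thesis by (auto simp: complex_nonpos_Reals_iff)
  qed
  have per: "g (x + v j) / f (x + v j) = g x / f x" for x j
  proof -
    have "exp (of_real (2 * pi * of_int (n j)) * \<i>) = 1" unfolding exp_eq_1 by auto
    then show ?thesis using assms(5) by (simp only: L(2,3) exp_add) simp
  qed
  show ?thesis
  proof (rule log_liftI[of "\<lambda>x. L x + Ln (g x / f x)"])
    show "continuous_on UNIV (\<lambda>x. L x + Ln (g x / f x))"
      using q f0 by (intro continuous_intros L assms) auto
    show "g x = exp (L x + Ln (g x / f x))" for x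
    proof -
      have "g x / f x \<noteq> 0" using q[of x] by auto
      then show ?thesis using f0[of x] by (simp add: exp_add L(2)[symmetric])
    qed
  qed (simp add: per L(3))
qed

text \<open>While \<open>s\<close> grows by 2\<pi> the line advances by \<open>m j\<close> periods
  in each coordinate \<open>j\<close>, so the increments add up with weights \<open>m\<close>. The
  index type \<open>unit\<close> stands for the single remaining period.\<close>

lemma log_lift_line:
  fixes f :: "real^'n \<Rightarrow> complex" and m :: "'n \<Rightarrow> nat"
  assumes "log_lift f (\<lambda>j. axis j (2 * pi)) n"
  shows "log_lift (\<lambda>s. f (\<theta> + s *\<^sub>R (\<chi> j. real (m j)))) (\<lambda>_::unit. 2 * pi)
           (\<lambda>_. \<Sum>j\<in>UNIV. int (m j) * n j)"
proof -
  obtain L where L: "continuous_on UNIV L" "\<And>x. f x = exp (L x)"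
    "\<And>x j. L (x + axis j (2 * pi)) = L x + of_real (2 * pi * of_int (n j)) * \<i>"
    using assms unfolding log_lift_def by blast
  have one: "L (x + axis j (2 * pi * real k)) = L x + of_real (2 * pi * of_int (int k * n j)) * \<i>" for x j k
  proof (induction k)
    case 0
    have "axis j (2 * pi * real 0) = (0 :: real^'n)" by (simp add: axis_def vec_eq_iff)
    then show ?case by (simp only: add_0_right) simp
  next
    case (Suc k)
    have "axis j (2 * pi * real (Suc k)) = axis j (2 * pi * real k) + (axis j (2 * pi) :: real^'n)"
      by (simp add: axis_def vec_eq_iff algebra_simps)
    then have "L (x + axis j (2 * pi * real (Suc k))) = L ((x + axis j (2 * pi * real k)) + axis j (2 * pi))"
      by (simp add: add.assoc)
    then show ?case unfolding L(3) Suc by (simp add: algebra_simps)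
  qed
  have many: "L (x + (\<Sum>j\<in>A. axis j (2 * pi * real (m j)))) =
      L x + of_real (2 * pi * of_int (\<Sum>j\<in>A. int (m j) * n j)) * \<i>" if "finite A" for x A
    using that
  proof (induction A rule: finite_induct)
    case (insert a A)
    have "L (x + (\<Sum>j\<in>insert a A. axis j (2 * pi * real (m j)))) =
        L ((x + (\<Sum>j\<in>A. axis j (2 * pi * real (m j)))) + axis a (2 * pi * real (m a)))"
      using insert by (simp add: algebra_simps)
    then show ?case unfolding one insert.IH using insert by (simp add: algebra_simps)
  qed simp
  have vec: "(\<Sum>j\<in>UNIV. axis j (2 * pi * real (m j))) = (2 * pi) *\<^sub>R (\<chi> j. real (m j))"
    by (simp add: vec_eq_iff axis_def if_distrib sum.delta cong: if_cong)
  show ?thesis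
  proof (rule log_liftI[of "\<lambda>s. L (\<theta> + s *\<^sub>R (\<chi> j. real (m j)))"])
    show "continuous_on UNIV (\<lambda>s. L (\<theta> + s *\<^sub>R (\<chi> j. real (m j))))"
      by (intro continuous_on_compose2[OF L(1)] continuous_intros) auto
    show "L (\<theta> + (s + 2 * pi) *\<^sub>R (\<chi> j. real (m j))) = L (\<theta> + s *\<^sub>R (\<chi> j. real (m j))) +
        of_real (2 * pi * of_int (\<Sum>j\<in>UNIV. int (m j) * n j)) * \<i>" for s
      using many[of UNIV "\<theta> + s *\<^sub>R (\<chi> j. real (m j))"] unfolding vec
      by (simp add: scaleR_add_left add.assoc)
  qed (simp add: L)
qed

section \<open>Winding numbers of one-variable polynomials on circles\<close>

lemma cis_add_2pi [simp]: "cis (x + 2 * pi) = cis x"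
  by (simp add: complex_eq_iff)

lemma log_lift_circle_cis: "R > 0 \<Longrightarrow> log_lift (\<lambda>s. of_real R * cis s) (\<lambda>_::unit. 2 * pi) (\<lambda>_. 1)"
  by (rule log_liftI[of "\<lambda>s. of_real (ln R) + \<i> * of_real s"])
    (auto intro!: continuous_intros simp: exp_add cis_conv_exp algebra_simps exp_of_real)

text \<open>Rouche against the larger of the two terms: the circle itself if the root is inside, the
  constant \<open>-a\<close> if it is outside.\<close>

lemma log_lift_circle_linear:
  assumes "R > 0" "cmod a \<noteq> R"
  shows "log_lift (\<lambda>s. of_real R * cis s - a) (\<lambda>_::unit. 2 * pi) (\<lambda>_. if cmod a < R then 1 else 0)"
proof (cases "cmod a < R")
  case True
  have "log_lift (\<lambda>s. of_real R * cis s - a) (\<lambda>_::unit. 2 * pi) (\<lambda>_. 1)"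
    by (rule log_lift_rouche[OF log_lift_circle_cis[OF assms(1)]])
      (use True assms in \<open>auto intro!: continuous_intros simp: norm_mult\<close>)
  then show ?thesis using True by simp
next
  case False
  then have "a \<noteq> 0" using assms by auto
  have "log_lift (\<lambda>s. of_real R * cis s - a) (\<lambda>_::unit. 2 * pi) (\<lambda>_. 0)"
    by (rule log_lift_rouche[OF log_lift_const[of "-a"]])
      (use False assms \<open>a \<noteq> 0\<close> in \<open>auto intro!: continuous_intros simp: norm_mult\<close>)
  then show ?thesis using False by simp
qed

text \<open>The argument principle, read off from the factorisation into linear factors. The
  multiset \<open>A\<close> of roots is obtained before the radius, so that circles of different
  radii can be compared.\<close>

lemma log_lift_circle_poly:
  assumes "P \<noteq> 0"
  obtains A where "\<And>w. poly P w = 0 \<longleftrightarrow> w \<in># A"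
    "\<And>R. \<lbrakk>R > 0; \<And>w. cmod w = R \<Longrightarrow> poly P w \<noteq> 0\<rbrakk> \<Longrightarrow>
       log_lift (\<lambda>s. poly P (of_real R * cis s)) (\<lambda>_::unit. 2 * pi)
         (\<lambda>_. int (size (filter_mset (\<lambda>a. cmod a < R) A)))"
proof -
  obtain A where A: "P = smult (lead_coeff P) (\<Prod>x\<in>#A. [:-x, 1:])"
    using alg_closed_imp_factorization[OF assms] by blast
  define c where "c = lead_coeff P"
  have "c \<noteq> 0" using assms by (simp add: c_def)
  have ev: "poly P w = c * (\<Prod>x\<in>#A. w - x)" for w
    by (subst A, fold c_def, simp add: poly_prod_mset)
  have roots: "poly P w = 0 \<longleftrightarrow> w \<in># A" for w
    unfolding ev using \<open>c \<noteq> 0\<close> by (auto simp: prod_mset_zero_iff)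
  have "log_lift (\<lambda>s. poly P (of_real R * cis s)) (\<lambda>_::unit. 2 * pi)
         (\<lambda>_. int (size (filter_mset (\<lambda>a. cmod a < R) A)))"
    if "R > 0" "\<And>w. cmod w = R \<Longrightarrow> poly P w \<noteq> 0" for R
  proof -
    have "\<And>a. a \<in># A \<Longrightarrow> cmod a \<noteq> R" using that(2) roots by blast
    then have "log_lift (\<lambda>s. (\<Prod>x\<in>#A. of_real R * cis s - x)) (\<lambda>_::unit. 2 * pi)
         (\<lambda>_. int (size (filter_mset (\<lambda>a. cmod a < R) A)))"
    proof (induction A)
      case (add a A)
      have "log_lift (\<lambda>s. (of_real R * cis s - a) * (\<Prod>x\<in>#A. of_real R * cis s - x)) (\<lambda>_::unit. 2 * pi)
         (\<lambda>_. (if cmod a < R then 1 else 0) + int (size (filter_mset (\<lambda>a. cmod a < R) A)))"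
        by (intro log_lift_mult log_lift_circle_linear \<open>R > 0\<close> add) (use add.prems in auto)
      moreover have "(\<lambda>_::unit. (if cmod a < R then 1 else 0) + int (size (filter_mset (\<lambda>a. cmod a < R) A)))
         = (\<lambda>_. int (size (filter_mset (\<lambda>a. cmod a < R) (add_mset a A))))" by auto
      ultimately show ?case by simp
    qed (simp add: log_lift_const)
    from log_lift_mult[OF log_lift_const[OF \<open>c \<noteq> 0\<close>] this] show ?thesis by (simp add: ev)
  qed
  with that roots show thesis by blast
qed

text \<open>The roots in the smaller disc form a submultiset of those in the larger one; equal
  winding numbers make the sizes, hence the multisets, equal.\<close>

lemma circle_poly_no_zeros_annulus:
  assumes "0 < R" "R < R'"
    and "log_lift (\<lambda>s. poly P (of_real R * cis s)) (\<lambda>_::unit. 2 * pi) (\<lambda>_. k)"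
    and "log_lift (\<lambda>s. poly P (of_real R' * cis s)) (\<lambda>_::unit. 2 * pi) (\<lambda>_. k)"
    and w: "R \<le> cmod w" "cmod w \<le> R'"
  shows "poly P w \<noteq> 0"
proof
  assume w0: "poly P w = 0"
  have nz: "poly P u \<noteq> 0" if "cmod u = R \<or> cmod u = R'" for u
    using that log_lift_nonzero[OF assms(3), of "Arg u"] log_lift_nonzero[OF assms(4), of "Arg u"]
    by (auto simp: cis_Arg rcis_cmod_Arg rcis_def[symmetric])
  have "P \<noteq> 0" using nz[of "of_real R"] assms by auto
  then obtain A where A: "\<And>w. poly P w = 0 \<longleftrightarrow> w \<in># A"
    "\<And>R. \<lbrakk>R > 0; \<And>w. cmod w = R \<Longrightarrow> poly P w \<noteq> 0\<rbrakk> \<Longrightarrow>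
       log_lift (\<lambda>s. poly P (of_real R * cis s)) (\<lambda>_::unit. 2 * pi)
         (\<lambda>_. int (size (filter_mset (\<lambda>a. cmod a < R) A)))"
    using log_lift_circle_poly by metis
  have "(\<lambda>_::unit. k) = (\<lambda>_. int (size (filter_mset (\<lambda>a. cmod a < R) A)))"
    by (rule log_lift_unique[OF assms(3) A(2)]) (use assms nz in auto)
  moreover have "(\<lambda>_::unit. k) = (\<lambda>_. int (size (filter_mset (\<lambda>a. cmod a < R') A)))"
    by (rule log_lift_unique[OF assms(4) A(2)]) (use assms nz in auto)
  ultimately have sz: "size (filter_mset (\<lambda>a. cmod a < R) A) = size (filter_mset (\<lambda>a. cmod a < R') A)"
    by (metis of_nat_eq_iff)
  have "filter_mset (\<lambda>a. cmod a < R) A \<subseteq># filter_mset (\<lambda>a. cmod a < R') A"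
    using assms(2) by (intro filter_mset_mono_strong) auto
  then have eq: "filter_mset (\<lambda>a. cmod a < R) A = filter_mset (\<lambda>a. cmod a < R') A"
    using sz by (metis size_mset_mono mset_subset_size subset_mset.le_imp_less_or_eq less_irrefl)
  have "cmod w < R'" using w nz[of w] w0 by fastforce
  then have "w \<in># filter_mset (\<lambda>a. cmod a < R') A" using w0 A(1) by simp
  then show False using w unfolding eq[symmetric] by simp
qed

text \<open>The winding number \<open>k\<close> is the number of roots in the disc, with
  multiplicity.\<close>

lemma circle_poly_zero_free_disc:
  assumes "0 < R"
    and "log_lift (\<lambda>s. poly P (of_real R * cis s)) (\<lambda>_::unit. 2 * pi) (\<lambda>_. k)"
  shows "0 \<le> k" and "k = 0 \<longleftrightarrow> (\<forall>w. cmod w \<le> R \<longrightarrow> poly P w \<noteq> 0)"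
proof -
  have nz: "poly P u \<noteq> 0" if "cmod u = R" for u
    using that log_lift_nonzero[OF assms(2), of "Arg u"]
    by (auto simp: cis_Arg rcis_cmod_Arg rcis_def[symmetric])
  have "P \<noteq> 0" using nz[of "of_real R"] assms by auto
  then obtain A where A: "\<And>w. poly P w = 0 \<longleftrightarrow> w \<in># A"
    "\<And>R. \<lbrakk>R > 0; \<And>w. cmod w = R \<Longrightarrow> poly P w \<noteq> 0\<rbrakk> \<Longrightarrow>
       log_lift (\<lambda>s. poly P (of_real R * cis s)) (\<lambda>_::unit. 2 * pi)
         (\<lambda>_. int (size (filter_mset (\<lambda>a. cmod a < R) A)))"
    using log_lift_circle_poly by metis
  have "(\<lambda>_::unit. k) = (\<lambda>_. int (size (filter_mset (\<lambda>a. cmod a < R) A)))"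
    by (rule log_lift_unique[OF assms(2) A(2)]) (use assms nz in auto)
  then have k: "k = int (size (filter_mset (\<lambda>a. cmod a < R) A))" by meson
  then show "0 \<le> k" by simp
  have "k = 0 \<longleftrightarrow> filter_mset (\<lambda>a. cmod a < R) A = {#}" using k by simp
  also have "\<dots> \<longleftrightarrow> (\<forall>a\<in>#A. \<not> cmod a < R)" by auto
  also have "\<dots> \<longleftrightarrow> (\<forall>w. cmod w \<le> R \<longrightarrow> poly P w \<noteq> 0)"
    using A(1) nz by (metis order_le_less not_le)
  finally show "k = 0 \<longleftrightarrow> (\<forall>w. cmod w \<le> R \<longrightarrow> poly P w \<noteq> 0)" .
qed

section \<open>Tori and their orders\<close>

text \<open>The angles range over the whole vector space and radii may be zero, so that the
  degenerate tori over the boundary of the triangle are treated in the same way as the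
  others.\<close>

definition torus_pt :: "real^'n \<Rightarrow> real^'n \<Rightarrow> complex^'n" where
  "torus_pt \<rho> \<theta> = (\<chi> j. of_real (\<rho>$j) * cis (\<theta>$j))"

definition torus_order :: "(complex^'n \<Rightarrow> complex) \<Rightarrow> real^'n \<Rightarrow> ('n \<Rightarrow> int) \<Rightarrow> bool" where
  "torus_order p \<rho> n \<longleftrightarrow> log_lift (\<lambda>\<theta>. p (torus_pt \<rho> \<theta>)) (\<lambda>j. axis j (2 * pi)) n"

lemma torus_pt_nth [simp]: "torus_pt \<rho> \<theta> $ j = of_real (\<rho>$j) * cis (\<theta>$j)"
  by (simp add: torus_pt_def)

lemma torus_pt_periodic [simp]: "torus_pt \<rho> (\<theta> + axis j (2 * pi)) = torus_pt \<rho> \<theta>"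
  by (simp add: vec_eq_iff axis_def)

lemma torus_pt_Arg:
  assumes "\<And>j. cmod (z$j) = \<rho>$j"
  shows "torus_pt \<rho> (\<chi> j. Arg (z$j)) = z"
  using assms by (simp add: vec_eq_iff rcis_def[symmetric] rcis_cmod_Arg flip: assms)

lemma continuous_on_torus_pt [continuous_intros]:
  assumes "continuous_on S f" "continuous_on S g"
  shows "continuous_on S (\<lambda>x. torus_pt (f x) (g x))"
  unfolding torus_pt_def using assms
  by (auto simp: cis_conv_exp intro!: continuous_intros continuous_on_component)

lemma norm_torus_pt [simp]: "norm (torus_pt \<rho> \<theta>) = norm \<rho>"
  by (simp add: norm_vec_def norm_mult)

lemma dist_torus_pt [simp]: "dist (torus_pt \<rho> \<theta>) (torus_pt \<rho>' \<theta>) = dist \<rho> \<rho>'"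
  by (simp add: dist_norm norm_vec_def norm_mult flip: left_diff_distrib of_real_diff)

lemma torus_order_nonzero: "torus_order p \<rho> n \<Longrightarrow> p (torus_pt \<rho> \<theta>) \<noteq> 0"
  unfolding torus_order_def by (rule log_lift_nonzero)

lemma torus_order_unique: "torus_order p \<rho> n \<Longrightarrow> torus_order p \<rho> n' \<Longrightarrow> n = n'"
  unfolding torus_order_def by (rule log_lift_unique)

lemma torus_order_exists:
  assumes "continuous_on UNIV p" "\<And>\<theta>. p (torus_pt \<rho> \<theta>) \<noteq> 0"
  shows "\<exists>n. torus_order p \<rho> n"
  unfolding torus_order_def using assms
  by (intro log_lift_exists) (auto intro!: continuous_intros continuous_on_compose2[OF assms(1)])

text \<open>Function and radii may change at once: with \<open>q = p\<close> this gives stability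
  under small changes of the radii, with equal radii it gives domination by a main term.\<close>

lemma torus_order_rouche:
  assumes "torus_order p \<rho> n" "continuous_on UNIV p" "continuous_on UNIV q"
    "\<And>\<theta>. cmod (q (torus_pt \<rho>' \<theta>) - p (torus_pt \<rho> \<theta>)) < cmod (p (torus_pt \<rho> \<theta>))"
  shows "torus_order q \<rho>' n"
  unfolding torus_order_def
  by (rule log_lift_rouche[OF assms(1)[unfolded torus_order_def]])
    (use assms(4) in \<open>auto intro!: continuous_intros continuous_on_compose2[OF assms(2)]
      continuous_on_compose2[OF assms(3)]\<close>)

lemma torus_order_mult:
  "torus_order p \<rho> n \<Longrightarrow> torus_order q \<rho> m \<Longrightarrow> torus_order (\<lambda>z. p z * q z) \<rho> (\<lambda>j. n j + m j)"
  unfolding torus_order_def by (rule log_lift_mult)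

lemma torus_order_const: "c \<noteq> 0 \<Longrightarrow> torus_order (\<lambda>_. c) \<rho> (\<lambda>_. 0)"
  unfolding torus_order_def by (rule log_lift_const)

lemma torus_order_prod:
  "finite A \<Longrightarrow> (\<And>i. i \<in> A \<Longrightarrow> torus_order (p i) \<rho> (n i)) \<Longrightarrow>
     torus_order (\<lambda>z. \<Prod>i\<in>A. p i z) \<rho> (\<lambda>j. \<Sum>i\<in>A. n i j)"
  unfolding torus_order_def by (rule log_lift_prod)

lemma torus_order_coord:
  fixes \<rho> :: "real^'n"
  assumes "\<rho>$i > 0"
  shows "torus_order (\<lambda>z. z$i) \<rho> (\<lambda>j. if j = i then 1 else 0)"
  unfolding torus_order_def
  by (rule log_liftI[of "\<lambda>\<theta>. of_real (ln (\<rho>$i)) + \<i> * of_real (\<theta>$i)"])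
    (use assms in \<open>auto intro!: continuous_intros continuous_on_component
      simp: exp_add cis_conv_exp algebra_simps exp_of_real axis_def\<close>)

text \<open>The angles do not form a compact set, so the minimum is taken over the torus
  \<open>T\<close> itself, which is closed and bounded and is reached by the angles
  \<open>Arg\<close>.\<close>

lemma torus_lower_bound:
  fixes p :: "complex^'n \<Rightarrow> complex"
  assumes "continuous_on UNIV p" "\<And>j. \<rho>$j \<ge> 0" "\<And>\<theta>. p (torus_pt \<rho> \<theta>) \<noteq> 0"
  obtains e where "e > 0" "\<And>\<theta>. e \<le> cmod (p (torus_pt \<rho> \<theta>))"
proof -
  define T where "T = (\<Inter>j. {z::complex^'n. cmod (z$j) = \<rho>$j})"
  have T: "torus_pt \<rho> \<theta> \<in> T" for \<theta> using assms(2) by (simp add: T_def norm_mult)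
  have "closed T" unfolding T_def
    by (intro closed_INT ballI closed_Collect_eq continuous_intros continuous_on_component)
  moreover have "norm z \<le> norm \<rho>" if "z \<in> T" for z
  proof -
    have "\<And>j. \<rho>$j = cmod (z$j)" using that by (auto simp: T_def)
    then show ?thesis by (simp add: norm_vec_def)
  qed
  ultimately have "compact T" by (auto simp: compact_eq_bounded_closed bounded_iff)
  moreover have "T \<noteq> {}" using T by blast
  moreover have "continuous_on T (\<lambda>z. cmod (p z))"
    by (intro continuous_intros continuous_on_subset[OF assms(1)]) auto
  ultimately obtain x where x: "x \<in> T" "\<And>y. y \<in> T \<Longrightarrow> cmod (p x) \<le> cmod (p y)"
    using continuous_attains_inf[of T "\<lambda>z. cmod (p z)"] by blast
  have "torus_pt \<rho> (\<chi> j. Arg (x$j)) = x" by (rule torus_pt_Arg) (use x(1) in \<open>simp add: T_def\<close>)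
  then have "p x \<noteq> 0" using assms(3)[of "\<chi> j. Arg (x$j)"] by simp
  then show thesis using that[of "cmod (p x)"] x T by auto
qed

text \<open>Points with the same angles are exactly as far apart as their radii, so uniform
  continuity of \<open>p\<close> on a ball gives a bound independent of the angles.\<close>

lemma torus_close:
  fixes p :: "complex^'n \<Rightarrow> complex"
  assumes "continuous_on UNIV p" "e > 0"
  obtains \<delta> where "\<delta> > 0" "\<And>\<rho>' \<theta>. dist \<rho>' \<rho> < \<delta> \<Longrightarrow> cmod (p (torus_pt \<rho>' \<theta>) - p (torus_pt \<rho> \<theta>)) < e"
proof -
  have "uniformly_continuous_on (cball 0 (norm \<rho> + 1)) p"
    by (intro compact_uniformly_continuous continuous_on_subset[OF assms(1)]) auto
  then obtain \<delta> where \<delta>: "\<delta> > 0"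
    "\<And>x y. \<lbrakk>x \<in> cball 0 (norm \<rho> + 1); y \<in> cball 0 (norm \<rho> + 1); dist y x < \<delta>\<rbrakk> \<Longrightarrow> dist (p y) (p x) < e"
    unfolding uniformly_continuous_on_def using assms(2) by metis
  show thesis
  proof (rule that[of "min \<delta> 1"])
    fix \<rho>' \<theta> assume *: "dist \<rho>' \<rho> < min \<delta> 1"
    then have "norm \<rho>' \<le> norm \<rho> + 1" using norm_triangle_sub[of \<rho>' \<rho>] by (simp add: dist_norm)
    then show "cmod (p (torus_pt \<rho>' \<theta>) - p (torus_pt \<rho> \<theta>)) < e"
      using \<delta>(2)[of "torus_pt \<rho> \<theta>" "torus_pt \<rho>' \<theta>"] *
      by (simp add: dist_norm dist_torus_pt[unfolded dist_norm])
  qed (use \<delta> in auto)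
qed

lemma torus_order_nearby:
  fixes p :: "complex^'n \<Rightarrow> complex"
  assumes "continuous_on UNIV p" "\<And>j. \<rho>$j \<ge> 0" "torus_order p \<rho> n"
  obtains \<delta> where "\<delta> > 0" "\<And>\<rho>'. dist \<rho>' \<rho> < \<delta> \<Longrightarrow> torus_order p \<rho>' n"
proof -
  obtain e where e: "e > 0" "\<And>\<theta>. e \<le> cmod (p (torus_pt \<rho> \<theta>))"
    using torus_lower_bound[of p \<rho>] assms torus_order_nonzero by metis
  obtain \<delta> where \<delta>: "\<delta> > 0" "\<And>\<rho>' \<theta>. dist \<rho>' \<rho> < \<delta> \<Longrightarrow> cmod (p (torus_pt \<rho>' \<theta>) - p (torus_pt \<rho> \<theta>)) < e"
    using torus_close[OF assms(1) e(1), of \<rho>] by blast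
  show thesis
    using \<delta> e by (intro that[of \<delta>] torus_order_rouche[OF assms(3,1,1)]) (auto intro: less_le_trans)
qed

section \<open>Homogeneous forms on monomial curves\<close>

text \<open>Polynomiality is recorded only through restriction to monomial curves: this is the form
  in which it is used, and it passes to sums and products at once.\<close>

locale homogeneous_form =
  fixes p :: "complex^'n \<Rightarrow> complex" and d :: nat
  assumes cont: "continuous_on UNIV p"
    and homogeneous: "p (c *s z) = c ^ d * p z"
    and monomial_curve: "\<exists>P. \<forall>w. p (\<chi> j. z$j * w ^ m j) = poly P w"
begin

text \<open>On the circle of radius \<open>R\<close> the curve runs in the torus over \<rho>, its
  angles following a straight line of direction \<open>m\<close>.\<close>

lemma log_lift_monomial_curve:
  assumes "torus_order p \<rho> n" "\<And>w. p (\<chi> j. z$j * w ^ m j) = poly P w"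
    and "\<And>j. \<rho>$j = cmod (z$j) * R ^ m j" "R > 0"
  shows "log_lift (\<lambda>s. poly P (of_real R * cis s)) (\<lambda>_::unit. 2 * pi) (\<lambda>_. \<Sum>j\<in>UNIV. int (m j) * n j)"
proof -
  have "(\<chi> j. z$j * (of_real R * cis s) ^ m j) =
      torus_pt \<rho> ((\<chi> j. Arg (z$j)) + s *\<^sub>R (\<chi> j. real (m j)))" for s
  proof -
    have "z$j * (of_real R * cis s) ^ m j = of_real (\<rho>$j) * cis (Arg (z$j) + s * real (m j))" for j
    proof -
      have "of_real r * cis a * (of_real R * cis s) ^ k = of_real (r * R ^ k) * cis (a + s * real k)" for r a k
        unfolding power_mult_distrib Complex.DeMoivre cis_mult[symmetric] of_real_mult of_real_power
        by (simp only: mult_ac)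
      from this[of "cmod (z$j)" "Arg (z$j)" "m j"] show ?thesis
        using rcis_cmod_Arg[of "z$j"] unfolding rcis_def assms(3) by simp
    qed
    then show ?thesis by (simp add: vec_eq_iff)
  qed
  then have "poly P (of_real R * cis s) = p (torus_pt \<rho> ((\<chi> j. Arg (z$j)) + s *\<^sub>R (\<chi> j. real (m j))))" for s
    using assms(2)[of "of_real R * cis s"] by simp
  then show ?thesis
    using log_lift_line[OF assms(1)[unfolded torus_order_def], of "\<chi> j. Arg (z$j)" m] by simp
qed

text \<open>The monomial curves over the segment have no zeros in the corresponding annulus.\<close>

lemma torus_order_segment:
  assumes "torus_order p \<rho> n" "torus_order p (\<chi> j. \<rho>$j * s ^ m j) n"
    and "\<And>j. \<rho>$j > 0" "s > 1" "1 \<le> \<tau>" "\<tau> \<le> s"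
  shows "p (torus_pt (\<chi> j. \<rho>$j * \<tau> ^ m j) \<theta>) \<noteq> 0"
proof -
  \<comment> \<open>With \<open>z\<close> at the angles \<theta>, the circles of radius 1 and
    \<open>s\<close> lie on the two given tori, and the point in question is the value of the curve
    at the real number \<tau>.\<close>
  define z where "z = torus_pt \<rho> \<theta>"
  have z: "cmod (z$j) = \<rho>$j" for j using assms(3)[of j] by (simp add: z_def norm_mult)
  obtain P where P: "\<And>w. p (\<chi> j. z$j * w ^ m j) = poly P w" using monomial_curve by metis
  have "poly P (of_real \<tau>) \<noteq> 0"
    by (rule circle_poly_no_zeros_annulus[of 1 s P "\<Sum>j\<in>UNIV. int (m j) * n j"];
        (rule log_lift_monomial_curve[OF _ P])?; (rule assms)?)
      (use assms(4-) z in auto)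
  moreover have "(\<chi> j. z$j * of_real \<tau> ^ m j) = torus_pt (\<chi> j. \<rho>$j * \<tau> ^ m j) \<theta>"
    by (simp add: vec_eq_iff z_def mult_ac)
  ultimately show ?thesis using P[of "of_real \<tau>"] by simp
qed

text \<open>With \<open>m\<close> a unit vector, the entry \<open>n i\<close> counts the zeros of
  \<open>p\<close> in the disc obtained by filling in the i-th circle through \<open>z\<close>. The
  point \<open>z\<close> of the torus is arbitrary, so one zero-free disc makes the discs through
  all other points zero-free as well.\<close>

lemma torus_order_coordinate_disc:
  assumes "torus_order p \<rho> n" "\<And>j. cmod (z$j) = \<rho>$j"
  shows "0 \<le> n i" and "n i = 0 \<longleftrightarrow> (\<forall>w. cmod w \<le> 1 \<longrightarrow> p (\<chi> j. if j = i then z$j * w else z$j) \<noteq> 0)"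
proof -
  define m where "m j = (if j = i then 1 else 0 :: nat)" for j
  obtain P where P: "\<And>w. p (\<chi> j. z$j * w ^ m j) = poly P w" using monomial_curve by metis
  have *: "log_lift (\<lambda>s. poly P (of_real 1 * cis s)) (\<lambda>_::unit. 2 * pi) (\<lambda>_. \<Sum>j\<in>UNIV. int (m j) * n j)"
    by (rule log_lift_monomial_curve[OF assms(1) P]) (use assms(2) in auto)
  have s: "(\<Sum>j\<in>UNIV. int (m j) * n j) = n i"
    by (simp add: m_def if_distrib[of int] if_distrib[of "\<lambda>x. x * _"] sum.delta cong: if_cong)
  have e: "(\<chi> j. z$j * w ^ m j) = (\<chi> j. if j = i then z$j * w else z$j)" for w
    by (simp add: vec_eq_iff m_def)
  show "0 \<le> n i" "n i = 0 \<longleftrightarrow> (\<forall>w. cmod w \<le> 1 \<longrightarrow> p (\<chi> j. if j = i then z$j * w else z$j) \<noteq> 0)"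
    using circle_poly_zero_free_disc[OF _ *] P by (simp_all add: s e)
qed

lemma torus_order_nonneg:
  assumes "torus_order p \<rho> n" "\<And>j. \<rho>$j \<ge> 0"
  shows "0 \<le> n i"
  using torus_order_coordinate_disc(1)[OF assms(1), of "torus_pt \<rho> 0" i] assms(2) by (simp add: norm_mult)

lemma torus_order_zero_ray:
  assumes "torus_order p \<rho> n" "n i = 0" "\<And>j. \<rho>$j \<ge> 0" "0 \<le> \<tau>" "\<tau> \<le> 1"
  shows "p (torus_pt (\<chi> j. if j = i then \<rho>$j * \<tau> else \<rho>$j) \<theta>) \<noteq> 0"
proof -
  have "p (\<chi> j. if j = i then torus_pt \<rho> \<theta> $ j * of_real \<tau> else torus_pt \<rho> \<theta> $ j) \<noteq> 0"
    using torus_order_coordinate_disc(2)[OF assms(1), of "torus_pt \<rho> \<theta>" i] assms(2-)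
    by (simp add: norm_mult)
  moreover have "(\<chi> j. if j = i then torus_pt \<rho> \<theta> $ j * of_real \<tau> else torus_pt \<rho> \<theta> $ j) =
      torus_pt (\<chi> j. if j = i then \<rho>$j * \<tau> else \<rho>$j) \<theta>" by (simp add: vec_eq_iff)
  ultimately show ?thesis by simp
qed

text \<open>Rotating all coordinates at once multiplies \<open>p\<close> by
  \<open>cis s ^ d\<close>, which makes \<open>d\<close> turns.\<close>

lemma torus_order_sum:
  assumes "torus_order p \<rho> n"
  shows "(\<Sum>j\<in>UNIV. n j) = int d"
proof -
  have "torus_pt \<rho> (0 + s *\<^sub>R (\<chi> j. real 1)) = cis s *s torus_pt \<rho> 0" for s
    by (simp add: vec_eq_iff)
  then have "p (torus_pt \<rho> (0 + s *\<^sub>R (\<chi> j. real 1))) = cis s ^ d * p (torus_pt \<rho> 0)" for s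
    by (simp only: homogeneous)
  then have 1: "log_lift (\<lambda>s. cis s ^ d * p (torus_pt \<rho> 0)) (\<lambda>_::unit. 2 * pi) (\<lambda>_. \<Sum>j\<in>UNIV. n j)"
    using log_lift_line[OF assms[unfolded torus_order_def], of 0 "\<lambda>_. 1"] by simp
  have "log_lift (\<lambda>s. (\<Prod>i<d. of_real 1 * cis s) * p (torus_pt \<rho> 0)) (\<lambda>_::unit. 2 * pi) (\<lambda>_. (\<Sum>i<d. 1) + 0)"
    by (intro log_lift_mult log_lift_prod log_lift_const log_lift_circle_cis torus_order_nonzero[OF assms]) auto
  then have "log_lift (\<lambda>s. cis s ^ d * p (torus_pt \<rho> 0)) (\<lambda>_::unit. 2 * pi) (\<lambda>_. int d)" by simp
  from log_lift_unique[OF 1 this] show ?thesis by meson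
qed

lemma torus_order_scale:
  assumes "torus_order p \<rho> n" "c > 0"
  shows "torus_order p (c *\<^sub>R \<rho>) n"
proof -
  have "p (torus_pt (c *\<^sub>R \<rho>) \<theta>) = p (torus_pt \<rho> \<theta>) * of_real c ^ d" for \<theta>
  proof -
    have "torus_pt (c *\<^sub>R \<rho>) \<theta> = of_real c *s torus_pt \<rho> \<theta>" by (simp add: vec_eq_iff)
    then show ?thesis by (simp add: homogeneous)
  qed
  then show ?thesis
    using torus_order_mult[OF assms(1) torus_order_const[of "of_real c ^ d"]] assms(2)
    by (simp add: torus_order_def)
qed

end

section \<open>The moment map in terms of radii\<close>

lemma pos_vec_nonzero: "(\<And>j. x$j > 0) \<Longrightarrow> x \<noteq> (0 :: real^'n)"
  by (metis less_irrefl zero_index)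

definition amoeba_pt :: "real^3 \<Rightarrow> real^3" where
  "amoeba_pt \<rho> = (\<chi> i. (\<rho>$i)\<^sup>2 / (\<Sum>j\<in>UNIV. (\<rho>$j)\<^sup>2))"

text \<open>On the triangle this is the section of \<open>amoeba_pt\<close> with values of norm
  1.\<close>

definition vec_sqrt :: "real^'n \<Rightarrow> real^'n" where
  "vec_sqrt r = (\<chi> i. sqrt (r$i))"

lemma vec_sqrt_nth [simp]: "vec_sqrt r $ i = sqrt (r$i)"
  by (simp add: vec_sqrt_def)

lemma sum_power2_eq_norm: "(\<Sum>j\<in>UNIV. (\<rho>$j)\<^sup>2) = (norm (\<rho>::real^'n))\<^sup>2"
  by (simp add: norm_vec_def L2_set_def sum_nonneg)

lemma amoeba_pt_nth: "amoeba_pt \<rho> $ i = (\<rho>$i / norm \<rho>)\<^sup>2"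
  by (simp add: amoeba_pt_def sum_power2_eq_norm power_divide)

lemma momentF_torus_pt: "momentF (torus_pt \<rho> \<theta>) = amoeba_pt \<rho>"
  by (simp add: momentF_def amoeba_pt_def norm_mult)

lemma amoeba_pt_scaleR: "c \<noteq> 0 \<Longrightarrow> amoeba_pt (c *\<^sub>R \<rho>) = amoeba_pt \<rho>"
  by (simp add: vec_eq_iff amoeba_pt_nth power_divide power_mult_distrib)

lemma amoeba_pt_simplex: "\<rho> \<noteq> 0 \<Longrightarrow> amoeba_pt \<rho> \<in> simplex2"
proof -
  assume "\<rho> \<noteq> 0"
  then have "(\<Sum>j\<in>UNIV. (\<rho>$j)\<^sup>2) \<noteq> 0" by (simp add: sum_power2_eq_norm)
  moreover have "amoeba_pt \<rho> $ 1 + amoeba_pt \<rho> $ 2 + amoeba_pt \<rho> $ 3 = (\<Sum>j\<in>UNIV. (\<rho>$j)\<^sup>2) / (\<Sum>j\<in>UNIV. (\<rho>$j)\<^sup>2)"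
    by (simp only: amoeba_pt_def sum_3 add_divide_distrib vec_lambda_beta)
  ultimately show ?thesis by (simp add: simplex2_def amoeba_pt_nth)
qed

lemma simplex_sum: "r \<in> simplex2 \<Longrightarrow> (\<Sum>j\<in>UNIV. r$j) = 1"
  by (simp add: simplex2_def sum_3)

lemma simplex_nonneg: "r \<in> simplex2 \<Longrightarrow> 0 \<le> r$i"
  by (simp add: simplex2_def)

lemma norm_vec_sqrt: "r \<in> simplex2 \<Longrightarrow> norm (vec_sqrt r) = 1"
  using simplex_sum[of r] simplex_nonneg[of r] by (simp add: norm_vec_def L2_set_def)

lemma vec_sqrt_nonzero: "r \<in> simplex2 \<Longrightarrow> vec_sqrt r \<noteq> 0"
  using norm_vec_sqrt by force

lemma amoeba_pt_vec_sqrt: "r \<in> simplex2 \<Longrightarrow> amoeba_pt (vec_sqrt r) = r"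
  by (simp add: vec_eq_iff amoeba_pt_nth norm_vec_sqrt simplex_nonneg)

lemma vec_sqrt_amoeba_pt:
  assumes "\<And>j. \<rho>$j \<ge> 0"
  shows "vec_sqrt (amoeba_pt \<rho>) = (1 / norm \<rho>) *\<^sub>R \<rho>"
  using assms by (simp add: vec_eq_iff amoeba_pt_nth)

lemma continuous_on_vec_sqrt: "continuous_on S vec_sqrt"
  unfolding vec_sqrt_def by (intro continuous_intros continuous_on_component)

lemma continuous_on_amoeba_pt: "0 \<notin> S \<Longrightarrow> continuous_on S amoeba_pt"
  unfolding amoeba_pt_def sum_power2_eq_norm
  by (intro continuous_intros continuous_on_component) auto

lemma floor_multiple_tendsto: "(\<lambda>N. of_int \<lfloor>real N * x\<rfloor> / real N) \<longlonglongrightarrow> (x::real)"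
proof -
  have "(\<lambda>N. of_int \<lfloor>real N * x\<rfloor> / real N - x) \<longlonglongrightarrow> 0"
  proof (rule Lim_null_comparison)
    show "\<forall>\<^sub>F N in sequentially. norm (of_int \<lfloor>real N * x\<rfloor> / real N - x) \<le> 1 / real N"
    proof (rule eventually_sequentiallyI[of 1])
      fix N :: nat assume "1 \<le> N"
      then have "of_int \<lfloor>real N * x\<rfloor> / real N - x = (of_int \<lfloor>real N * x\<rfloor> - real N * x) / real N"
        by (simp add: field_simps)
      moreover have "\<bar>of_int \<lfloor>real N * x\<rfloor> - real N * x\<bar> \<le> 1" by linarith
      ultimately show "norm (of_int \<lfloor>real N * x\<rfloor> / real N - x) \<le> 1 / real N"
        by (simp add: divide_right_mono)
    qed
    show "(\<lambda>N. 1 / real N) \<longlonglongrightarrow> 0" by (rule lim_1_over_n)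
  qed
  then show ?thesis by (simp add: LIM_zero_iff)
qed

text \<open>In logarithmic coordinates the direction \<open>x\<close> from \<rho> to
  \<open>y\<close> is replaced by the rational direction with entries
  \<open>\<lfloor>N * x j\<rfloor> / N\<close>; then \<open>s = exp (1/N)\<close> and
  \<open>m\<close> consists of the numerators. They are natural numbers because \<rho> lies below
  \<open>y\<close> in each entry.\<close>

lemma monomial_curve_approx:
  fixes \<rho> y :: "real^'n"
  assumes "\<And>j. \<rho>$j > 0" "\<And>j. \<rho>$j \<le> y$j" "\<delta> > 0"
  obtains s and m :: "'n \<Rightarrow> nat" where "s > 1" "dist (\<chi> j. \<rho>$j * s ^ m j) y < \<delta>"
proof -
  define x where "x j = ln (y$j / \<rho>$j)" for j
  define m where "m N j = nat \<lfloor>real N * x j\<rfloor>" for N j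
  have x0: "x j \<ge> 0" for j using assms(1,2)[of j] by (simp add: x_def)
  have "(\<lambda>N. \<chi> j. \<rho>$j * exp (of_int \<lfloor>real N * x j\<rfloor> / real N)) \<longlonglongrightarrow> (\<chi> j. \<rho>$j * exp (x j))"
    by (intro tendsto_vec_lambda tendsto_intros floor_multiple_tendsto)
  moreover have "(\<chi> j. \<rho>$j * exp (x j)) = y"
  proof -
    have "\<rho>$j * exp (x j) = y$j" for j using assms(1,2)[of j] by (simp add: x_def)
    then show ?thesis by (simp add: vec_eq_iff)
  qed
  ultimately have "\<forall>\<^sub>F N in sequentially. dist (\<chi> j. \<rho>$j * exp (of_int \<lfloor>real N * x j\<rfloor> / real N)) y < \<delta>"
    using assms(3) by (simp add: tendsto_iff)
  then obtain N where N: "N \<ge> 1" "dist (\<chi> j. \<rho>$j * exp (of_int \<lfloor>real N * x j\<rfloor> / real N)) y < \<delta>"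
    unfolding eventually_sequentially by (metis max.cobounded1 max.cobounded2)
  have "exp (of_int \<lfloor>real N * x j\<rfloor> / real N) = exp (1 / real N) ^ m N j" for j
    using x0[of j] by (simp add: m_def exp_of_nat_mult[symmetric])
  then show thesis using that[of "exp (1 / real N)" "m N"] N by simp
qed

lemma (in homogeneous_form) torus_order_normalize:
  fixes \<rho> :: "real^'n"
  assumes "\<rho> \<noteq> 0"
  shows "torus_order p ((1 / norm \<rho>) *\<^sub>R \<rho>) n \<longleftrightarrow> torus_order p \<rho> n"
proof
  assume "torus_order p ((1 / norm \<rho>) *\<^sub>R \<rho>) n"
  from torus_order_scale[OF this, of "norm \<rho>"] show "torus_order p \<rho> n" using assms by simp
qed (use assms torus_order_scale in auto)

section \<open>Components of the complement of the amoeba\<close>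

text \<open>The hypothesis \<open>boundary_nonzero\<close> forces the order of a torus close to the boundary to vanish in
  the corresponding entry, even near a point of the boundary that lies on the amoeba.\<close>

locale plane_curve = homogeneous_form p d for p :: "complex^3 \<Rightarrow> complex" and d +
  assumes boundary_nonzero: "\<lbrakk>\<And>j. \<rho>$j \<ge> 0; \<rho> \<noteq> 0; \<rho>$k = 0\<rbrakk> \<Longrightarrow> p (torus_pt \<rho> 0) \<noteq> 0"
begin

definition amoeba_compl :: "(real^3) set" where
  "amoeba_compl = simplex2 - momentF ` curve p"

definition order_at :: "real^3 \<Rightarrow> (3 \<Rightarrow> int) \<Rightarrow> bool" where
  "order_at r n \<longleftrightarrow> torus_order p (vec_sqrt r) n"

text \<open>A moment value fixes the moduli up to a common factor \<open>c\<close>, and homogeneity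
  keeps zeros under scaling.\<close>

lemma amoeba_pt_mem_image:
  assumes "\<And>j. \<rho>$j \<ge> 0" "\<rho> \<noteq> 0"
  shows "amoeba_pt \<rho> \<in> momentF ` curve p \<longleftrightarrow> (\<exists>\<theta>. p (torus_pt \<rho> \<theta>) = 0)"
proof
  assume "amoeba_pt \<rho> \<in> momentF ` curve p"
  then obtain z where z: "z \<noteq> 0" "p z = 0" "amoeba_pt \<rho> = momentF z" by (auto simp: curve_def)
  have n: "(\<Sum>j\<in>UNIV. (cmod (z$j))\<^sup>2) = (norm z)\<^sup>2"
    by (simp add: norm_vec_def L2_set_def sum_nonneg)
  define c where "c = norm \<rho> / norm z"
  have "cmod ((of_real c *s z) $ j) = \<rho>$j" for j
  proof -
    have "(\<rho>$j / norm \<rho>)\<^sup>2 = (cmod (z$j) / norm z)\<^sup>2"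
      using z(3) by (simp add: vec_eq_iff amoeba_pt_nth momentF_def n power_divide)
    then have "\<rho>$j / norm \<rho> = cmod (z$j) / norm z"
      using assms(1) by (simp add: power2_eq_iff_nonneg)
    then show ?thesis using assms(2) z(1)
      by (simp add: c_def norm_mult norm_divide) (simp add: field_simps)
  qed
  then have "torus_pt \<rho> (\<chi> j. Arg ((of_real c *s z) $ j)) = of_real c *s z" by (rule torus_pt_Arg)
  then have "p (torus_pt \<rho> (\<chi> j. Arg ((of_real c *s z) $ j))) = 0" by (simp only: homogeneous z(2)) simp
  then show "\<exists>\<theta>. p (torus_pt \<rho> \<theta>) = 0" by blast
next
  assume "\<exists>\<theta>. p (torus_pt \<rho> \<theta>) = 0"
  then obtain \<theta> where "p (torus_pt \<rho> \<theta>) = 0" by blast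
  moreover have "torus_pt \<rho> \<theta> \<noteq> 0" using assms(2) norm_torus_pt[of \<rho> \<theta>] by force
  ultimately show "amoeba_pt \<rho> \<in> momentF ` curve p"
    by (intro image_eqI[of _ _ "torus_pt \<rho> \<theta>"]) (auto simp: curve_def momentF_torus_pt)
qed

lemma order_at_exists: "r \<in> amoeba_compl \<Longrightarrow> \<exists>n. order_at r n"
  unfolding order_at_def amoeba_compl_def
  using amoeba_pt_mem_image[of "vec_sqrt r"] vec_sqrt_nonzero[of r] simplex_nonneg[of r]
  by (intro torus_order_exists cont) (auto simp: amoeba_pt_vec_sqrt)

lemma order_at_amoeba_pt:
  assumes "\<And>j. \<rho>$j \<ge> 0" "\<rho> \<noteq> 0"
  shows "order_at (amoeba_pt \<rho>) n \<longleftrightarrow> torus_order p \<rho> n"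
  using assms by (simp add: order_at_def vec_sqrt_amoeba_pt torus_order_normalize)

lemma order_at_nonneg: "r \<in> simplex2 \<Longrightarrow> order_at r n \<Longrightarrow> 0 \<le> n j"
  unfolding order_at_def by (rule torus_order_nonneg) (auto simp: simplex_nonneg)

lemma amoeba_pt_in_compl:
  assumes "\<And>j. \<rho>$j \<ge> 0" "\<rho> \<noteq> 0" "\<And>\<theta>. p (torus_pt \<rho> \<theta>) \<noteq> 0"
  shows "amoeba_pt \<rho> \<in> amoeba_compl"
  using assms amoeba_pt_mem_image[of \<rho>] amoeba_pt_simplex by (auto simp: amoeba_compl_def)

text \<open>Connecting sets are built in the space of radii, where monomial curves live; this
  carries them over to the triangle.\<close>

lemma connected_in_component:
  assumes "U \<in> components amoeba_compl" "connected C"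
    and C: "\<And>\<rho>. \<rho> \<in> C \<Longrightarrow> (\<forall>j. \<rho>$j \<ge> 0) \<and> \<rho> \<noteq> 0 \<and> (\<forall>\<theta>. p (torus_pt \<rho> \<theta>) \<noteq> 0)"
    and "\<rho> \<in> C" "amoeba_pt \<rho> \<in> U" "\<rho>' \<in> C"
  shows "amoeba_pt \<rho>' \<in> U"
proof -
  have "connected (amoeba_pt ` C)"
    by (intro connected_continuous_image continuous_on_amoeba_pt assms(2)) (use C in blast)
  moreover have "amoeba_pt ` C \<subseteq> amoeba_compl" using C amoeba_pt_in_compl by blast
  ultimately have "amoeba_pt ` C \<subseteq> U"
    using components_maximal[OF assms(1)] assms(4,5) by blast
  then show ?thesis using assms(6) by blast
qed

lemma order_at_nearby:
  assumes "r \<in> simplex2" "order_at r n"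
  obtains \<delta> where "\<delta> > 0" "\<And>r'. dist r' r < \<delta> \<Longrightarrow> order_at r' n"
proof -
  obtain e where e: "e > 0" "\<And>\<rho>'. dist \<rho>' (vec_sqrt r) < e \<Longrightarrow> torus_order p \<rho>' n"
    using torus_order_nearby[OF cont, of "vec_sqrt r" n] assms
    by (auto simp: order_at_def simplex_nonneg)
  obtain \<delta> where "\<delta> > 0" "\<And>r'. dist r' r < \<delta> \<Longrightarrow> dist (vec_sqrt r') (vec_sqrt r) < e"
    using continuous_on_vec_sqrt[of UNIV] e(1) unfolding continuous_on_iff by (metis UNIV_I)
  with e that show thesis by (auto simp: order_at_def)
qed

text \<open>Orders are locally constant, so having the same orders is an equivalence relation with
  relatively open classes on the connected set \<open>U\<close>.\<close>

lemma order_at_component: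
  assumes "U \<in> components amoeba_compl" "r \<in> U" "r' \<in> U" "order_at r n"
  shows "order_at r' n"
proof -
  have UX: "U \<subseteq> simplex2" using in_components_subset[OF assms(1)] by (auto simp: amoeba_compl_def)
  have "\<forall>n. order_at r n \<longleftrightarrow> order_at r' n"
  proof (rule connected_equivalence_relation[OF in_components_connected[OF assms(1)] assms(2,3)])
    fix a assume a: "a \<in> U"
    then obtain n where n: "order_at a n"
      using order_at_exists in_components_subset[OF assms(1)] by blast
    obtain \<delta> where \<delta>: "\<delta> > 0" "\<And>r'. dist r' a < \<delta> \<Longrightarrow> order_at r' n"
      using order_at_nearby[OF _ n] a UX by blast
    have "\<forall>x\<in>U \<inter> ball a \<delta>. \<forall>n. order_at a n \<longleftrightarrow> order_at x n"
    proof (intro ballI allI)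
      fix x k assume "x \<in> U \<inter> ball a \<delta>"
      then have "order_at x n" using \<delta>(2) by (simp add: dist_commute)
      then show "order_at a k \<longleftrightarrow> order_at x k"
        using n torus_order_unique unfolding order_at_def by blast
    qed
    then show "\<exists>T. openin (top_of_set U) T \<and> a \<in> T \<and> (\<forall>x\<in>T. \<forall>n. order_at a n \<longleftrightarrow> order_at x n)"
      using a \<delta>(1) by (intro exI[of _ "U \<inter> ball a \<delta>"]) auto
  qed auto
  then show ?thesis using assms(4) by blast
qed

lemma order_at_near_boundary:
  assumes "r \<in> simplex2" "r$k = 0"
  obtains \<delta> where "\<delta> > 0" "\<And>r' n. \<lbrakk>r' \<in> simplex2; dist r' r < \<delta>; order_at r' n\<rbrakk> \<Longrightarrow> n k = 0"
proof -
  let ?z = "torus_pt (vec_sqrt r) 0"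
  have "p ?z \<noteq> 0"
    by (rule boundary_nonzero[of _ k]) (use assms vec_sqrt_nonzero in \<open>auto simp: simplex_nonneg\<close>)
  then obtain e where e: "e > 0" "\<And>z. dist z ?z < e \<Longrightarrow> p z \<noteq> 0"
    using continuous_on_avoid[OF cont, of ?z 0] by (metis UNIV_I dist_commute)
  obtain \<delta> where \<delta>: "\<delta> > 0" "\<And>r'. dist r' r < \<delta> \<Longrightarrow> dist (vec_sqrt r') (vec_sqrt r) < e"
    using continuous_on_vec_sqrt[of UNIV] e(1) unfolding continuous_on_iff by (metis UNIV_I)
  show thesis
  proof (rule that[OF \<delta>(1)])
    fix r' n assume r': "r' \<in> simplex2" "dist r' r < \<delta>" "order_at r' n"
    let ?z' = "torus_pt (vec_sqrt r') 0"
    have "p (\<chi> j. if j = k then ?z'$j * w else ?z'$j) \<noteq> 0" if "cmod w \<le> 1" for w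
    proof -
      let ?u = "\<chi> j. if j = k then ?z'$j * w else ?z'$j"
      \<comment> \<open>In coordinate \<open>k\<close> the point \<open>?z\<close> is zero and
        \<open>w\<close> only shrinks the entry of \<open>?z'\<close>; the other coordinates do not
        depend on \<open>w\<close>.\<close>
      have "norm ((?u - ?z) $ j) \<le> norm ((vec_sqrt r' - vec_sqrt r) $ j)" for j
        using assms(2) that simplex_nonneg[OF r'(1), of k]
        by (auto simp: norm_mult mult_left_le simp flip: of_real_diff)
      then have "norm (?u - ?z) \<le> norm (vec_sqrt r' - vec_sqrt r)" by (rule norm_le_componentwise_cart)
      then show ?thesis using \<delta>(2)[OF r'(2)] e(2)[of ?u] by (simp add: dist_norm)
    qed
    then show "n k = 0"
      using torus_order_coordinate_disc(2)[OF r'(3)[unfolded order_at_def], of ?z' k]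
        simplex_nonneg[OF r'(1)] by (simp add: norm_mult)
  qed
qed

text \<open>If \<open>n j\<close> were zero, the j-th radius could shrink to zero through zero-free
  tori, and \<open>U\<close> would contain a boundary point.\<close>

lemma hole_order_positive:
  assumes "U \<in> holes (momentF ` curve p)"
  obtains r n where "r \<in> U" "\<And>j. r$j > 0" "order_at r n" "\<And>j. n j \<ge> 1"
proof -
  have U: "U \<in> components amoeba_compl" "U \<inter> simplex2_bdry = {}"
    using assms closure_subset[of U] unfolding holes_def amoeba_compl_def by auto
  then obtain r where r: "r \<in> U" using in_components_nonempty by blast
  then have rX: "r \<in> amoeba_compl" using in_components_subset[OF U(1)] by blast
  then have rs: "r \<in> simplex2" by (simp add: amoeba_compl_def)
  have pos: "r$j > 0" for j
    using r U(2) rs simplex_nonneg[OF rs, of j] by (force simp: simplex2_bdry_def)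
  obtain n where n: "order_at r n" using order_at_exists[OF rX] by blast
  have "n j \<noteq> 0" for j
  proof
    assume n0: "n j = 0"
    define g where "g \<tau> = (\<chi> i. if i = j then vec_sqrt r $ i * \<tau> else vec_sqrt r $ i)" for \<tau>
    have g1: "g 1 = vec_sqrt r" by (simp add: g_def vec_eq_iff)
    have "continuous_on {0..1} (\<lambda>\<tau>. g \<tau> $ i)" for i
      by (cases "i = j") (simp_all add: g_def continuous_on_mult_left continuous_on_id)
    then have "continuous_on {0..1} (\<lambda>\<tau>. \<chi> i. g \<tau> $ i)" by (rule continuous_on_vec_lambda)
    then have conn: "connected (g ` {0..1})" by (intro connected_continuous_image) simp_all
    have good: "(\<forall>i. g \<tau> $ i \<ge> 0) \<and> g \<tau> \<noteq> 0 \<and> (\<forall>\<theta>. p (torus_pt (g \<tau>) \<theta>) \<noteq> 0)"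
      if "\<tau> \<in> {0..1}" for \<tau>
    proof (intro conjI allI)
      show "0 \<le> g \<tau> $ i" for i using that rs by (simp add: g_def simplex_nonneg)
      \<comment> \<open>Index addition is cyclic, so \<open>j + 1\<close> is a coordinate whose
        positive radius stays fixed.\<close>
      have "g \<tau> $ (j + 1) \<noteq> 0" using pos[of "j + 1"] by (simp add: g_def)
      then show "g \<tau> \<noteq> 0" by auto
      show "p (torus_pt (g \<tau>) \<theta>) \<noteq> 0" for \<theta>
        unfolding g_def using that n n0 rs
        by (intro torus_order_zero_ray[of _ n]) (auto simp: order_at_def simplex_nonneg)
    qed
    have "amoeba_pt (g 1) \<in> U" using r rs by (simp add: g1 amoeba_pt_vec_sqrt)
    then have "amoeba_pt (g 0) \<in> U"
      by (rule connected_in_component[OF U(1) conn, rotated 2]) (use good in auto)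
    moreover have "amoeba_pt (g 0) $ j = 0" by (simp add: amoeba_pt_nth g_def)
    ultimately show False
      using U in_components_subset[OF U(1)] by (auto simp: simplex2_bdry_def amoeba_compl_def)
  qed
  then have "n j \<ge> 1" for j using order_at_nonneg[OF rs n, of j] by (smt (verit))
  then show thesis using that r pos n by blast
qed

text \<open>At a boundary point in the closure of \<open>U\<close>, nearby points of
  \<open>U\<close> would have an order with a zero entry, but the order is constant on
  \<open>U\<close>.\<close>

lemma order_positive_hole:
  assumes "U \<in> components amoeba_compl" "r \<in> U" "order_at r n" "\<And>j. n j \<ge> 1"
  shows "U \<in> holes (momentF ` curve p)"
proof -
  have UX: "U \<subseteq> simplex2" using in_components_subset[OF assms(1)] by (auto simp: amoeba_compl_def)
  have False if b: "b \<in> closure U" "b \<in> simplex2_bdry" for b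
  proof -
    obtain k where k: "b \<in> simplex2" "b$k = 0" using b(2) by (auto simp: simplex2_bdry_def)
    obtain \<delta> where \<delta>: "\<delta> > 0" "\<And>r' n. \<lbrakk>r' \<in> simplex2; dist r' b < \<delta>; order_at r' n\<rbrakk> \<Longrightarrow> n k = 0"
      using order_at_near_boundary[OF k] by metis
    obtain r' where r': "r' \<in> U" "dist r' b < \<delta>" using b(1) \<delta>(1) closure_approachable by blast
    have "order_at r' n" by (rule order_at_component[OF assms(1,2) r'(1) assms(3)])
    then have "n k = 0" using \<delta>(2) r' UX by blast
    then show False using assms(4)[of k] by simp
  qed
  then show ?thesis using assms(1) by (auto simp: holes_def amoeba_compl_def)
qed

text \<open>Only directions with integer entries are accessible along monomial curves, so the second torus
  is first moved slightly, to one reached from the first along such a curve.\<close>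

lemma equal_order_same_component:
  assumes U: "U \<in> components amoeba_compl" and V: "V \<in> components amoeba_compl"
    and r: "r \<in> U" "\<And>j. r$j > 0" "order_at r n" and r': "r' \<in> V" "\<And>j. r'$j > 0" "order_at r' n"
  shows "U = V"
proof -
  have rs: "r \<in> simplex2" "r' \<in> simplex2"
    using r(1) r'(1) in_components_subset[OF U] in_components_subset[OF V]
    by (auto simp: amoeba_compl_def)
  define \<rho> where "\<rho> = vec_sqrt r"
  \<comment> \<open>Scaling does not move the point of the triangle; this factor lifts the second
    torus above the first in every entry, so that the connecting exponents are natural
    numbers.\<close>
  define c where "c = (\<Sum>j\<in>UNIV. \<rho>$j / sqrt (r'$j))"
  define y where "y = c *\<^sub>R vec_sqrt r'"
  have \<rho>: "\<rho>$j > 0" for j using r(2) by (simp add: \<rho>_def)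
  have le: "\<rho>$j \<le> y$j" for j
  proof -
    have "\<rho>$j / sqrt (r'$j) \<le> c" unfolding c_def
      by (rule member_le_sum) (use r'(2) \<rho> in \<open>auto intro!: divide_nonneg_nonneg simp: less_imp_le\<close>)
    then show ?thesis using r'(2)[of j] by (simp add: y_def pos_divide_le_eq)
  qed
  have y: "y$j > 0" for j using le[of j] \<rho>[of j] by linarith
  then have c: "c > 0" using r'(2)[of 1] y[of 1] by (auto simp: y_def zero_less_mult_iff)
  have yn: "torus_order p y n"
    using torus_order_scale[OF r'(3)[unfolded order_at_def] c] by (simp add: y_def)
  obtain \<delta> where \<delta>: "\<delta> > 0" "\<And>x. dist x y < \<delta> \<Longrightarrow> torus_order p x n"
    using torus_order_nearby[OF cont _ yn] y less_imp_le by metis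
  obtain s and m :: "3 \<Rightarrow> nat" where s: "s > 1" "dist (\<chi> j. \<rho>$j * s ^ m j) y < \<delta>"
    using monomial_curve_approx[OF \<rho> le \<delta>(1)] by metis
  define g where "g \<tau> = (\<chi> j. \<rho>$j * \<tau> ^ m j)" for \<tau>
  have gs: "torus_order p (g s) n" using \<delta>(2) s(2) by (simp add: g_def)
  have g1: "g 1 = \<rho>" by (simp add: g_def vec_eq_iff)
  have gpos: "g \<tau> $ j > 0" if "\<tau> \<ge> 1" for \<tau> j using that \<rho> by (simp add: g_def)
  have conn: "connected (g ` {1..s})"
    unfolding g_def by (intro connected_continuous_image continuous_on_vec_lambda continuous_intros) auto
  have good: "(\<forall>j. g \<tau> $ j \<ge> 0) \<and> g \<tau> \<noteq> 0 \<and> (\<forall>\<theta>. p (torus_pt (g \<tau>) \<theta>) \<noteq> 0)"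
    if "\<tau> \<in> {1..s}" for \<tau>
  proof (intro conjI allI)
    show "0 \<le> g \<tau> $ j" for j using gpos that by (simp add: less_imp_le)
    show "g \<tau> \<noteq> 0" using gpos that by (intro pos_vec_nonzero) auto
    show "p (torus_pt (g \<tau>) \<theta>) \<noteq> 0" for \<theta>
      unfolding g_def using torus_order_segment[of \<rho> n s m \<tau> \<theta>] r(3) gs \<rho> s that
      by (auto simp: g_def order_at_def \<rho>_def)
  qed
  have "amoeba_pt (g 1) \<in> U" using r(1) rs by (simp add: g1 \<rho>_def amoeba_pt_vec_sqrt)
  then have gU: "amoeba_pt (g s) \<in> U"
    by (rule connected_in_component[OF U conn, rotated 2]) (use good s(1) in auto)
  \<comment> \<open>The small error is bridged by a straight segment within the ball around
    \<open>y\<close> on which the order remains \<open>n\<close>.\<close>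
  have "amoeba_pt y \<in> U"
  proof (rule connected_in_component[OF U connected_segment(1) _ _ gU])
    fix x assume x: "x \<in> closed_segment (g s) y"
    then obtain u where u: "0 \<le> u" "u \<le> 1" "x = (1 - u) *\<^sub>R g s + u *\<^sub>R y"
      by (auto simp: closed_segment_def)
    have xpos: "x$j > 0" for j
    proof -
      have "min (g s $ j) (y $ j) \<le> x$j"
        using u convex_bound_le[of "- (g s $ j)" "- min (g s $ j) (y $ j)" "- (y $ j)" "1 - u" u] by simp
      then show ?thesis using gpos[of s j] s(1) y[of j] by linarith
    qed
    have "x \<in> ball y \<delta>"
      using x s(2) \<delta>(1) closed_segment_subset[of "g s" "ball y \<delta>" y]
      by (auto simp: g_def dist_commute)
    then have "torus_order p x n" using \<delta>(2) by (simp add: dist_commute)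
    then show "(\<forall>j. x$j \<ge> 0) \<and> x \<noteq> 0 \<and> (\<forall>\<theta>. p (torus_pt x \<theta>) \<noteq> 0)"
      using xpos pos_vec_nonzero[of x] torus_order_nonzero[of p x n] by (simp add: less_imp_le)
  qed auto
  moreover have "amoeba_pt y = r'" using c rs by (simp add: y_def amoeba_pt_scaleR amoeba_pt_vec_sqrt)
  ultimately show ?thesis using r'(1) components_eq[OF U V] by auto
qed

text \<open>An order is sent to the component of a chosen torus having it. Injectivity holds since a
  component has one order, surjectivity since equal orders mean equal components.\<close>

lemma bij_betw_positive_orders_holes:
  assumes "\<And>n. \<lbrakk>\<And>j. n j \<ge> 1; (\<Sum>j\<in>UNIV. n j) = int d\<rbrakk> \<Longrightarrow> \<exists>\<rho>. (\<forall>j. \<rho>$j > 0) \<and> torus_order p \<rho> n"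
  defines "I \<equiv> {n :: 3 \<Rightarrow> int. (\<forall>j. n j \<ge> 1) \<and> (\<Sum>j\<in>UNIV. n j) = int d}"
  shows "\<exists>G. bij_betw G I (holes (momentF ` curve p))"
proof -
  obtain R where R: "\<And>n. n \<in> I \<Longrightarrow> (\<forall>j. R n $ j > 0) \<and> torus_order p (R n) n"
    using assms(1) unfolding I_def by (metis (mono_tags, lifting) mem_Collect_eq)
  define G where "G n = connected_component_set amoeba_compl (amoeba_pt (R n))" for n
  have G: "G n \<in> components amoeba_compl" "amoeba_pt (R n) \<in> G n" "\<And>j. amoeba_pt (R n) $ j > 0"
    "order_at (amoeba_pt (R n)) n" if "n \<in> I" for n
  proof -
    have n: "R n \<noteq> 0" "\<And>j. R n $ j \<ge> 0" "\<And>j. R n $ j > 0" "torus_order p (R n) n"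
      using R[OF that] pos_vec_nonzero[of "R n"] by (auto simp: less_imp_le)
    then have X: "amoeba_pt (R n) \<in> amoeba_compl"
      using torus_order_nonzero[OF n(4)] by (intro amoeba_pt_in_compl) auto
    then show "G n \<in> components amoeba_compl" "amoeba_pt (R n) \<in> G n"
      by (auto simp: G_def componentsI)
    show "amoeba_pt (R n) $ j > 0" for j using n(1) n(3)[of j] by (simp add: amoeba_pt_nth)
    show "order_at (amoeba_pt (R n)) n" using n by (simp add: order_at_amoeba_pt)
  qed
  have "inj_on G I"
  proof (rule inj_onI)
    fix n n' assume *: "n \<in> I" "n' \<in> I" "G n = G n'"
    then have "amoeba_pt (R n') \<in> G n" using G(2)[OF *(2)] by simp
    then have "order_at (amoeba_pt (R n')) n"
      using order_at_component[OF G(1,2) _ G(4)] * by blast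
    then show "n = n'" using G(4)[OF *(2)] torus_order_unique unfolding order_at_def by blast
  qed
  moreover have "G n \<in> holes (momentF ` curve p)" if "n \<in> I" for n
    using order_positive_hole[OF G(1,2,4)] that by (auto simp: I_def)
  moreover have "U \<in> G ` I" if U: "U \<in> holes (momentF ` curve p)" for U
  proof -
    obtain r n where r: "r \<in> U" "\<And>j. r$j > 0" "order_at r n" "\<And>j. n j \<ge> 1"
      using hole_order_positive[OF U] by metis
    have "n \<in> I" using r(4) torus_order_sum[OF r(3)[unfolded order_at_def]] by (simp add: I_def)
    moreover have "U \<in> components amoeba_compl" using U by (auto simp: holes_def amoeba_compl_def)
    ultimately have "U = G n" using equal_order_same_component[OF _ G(1) r(1-3) G(2,3,4)] by blast
    then show ?thesis using \<open>n \<in> I\<close> by blast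
  qed
  ultimately show ?thesis unfolding bij_betw_def by blast
qed

end

section \<open>Counting positive orders\<close>

lemma card_positive_triples:
  "finite {n :: 3 \<Rightarrow> int. (\<forall>j. n j \<ge> 1) \<and> (\<Sum>j\<in>UNIV. n j) = int d}"
  "card {n :: 3 \<Rightarrow> int. (\<forall>j. n j \<ge> 1) \<and> (\<Sum>j\<in>UNIV. n j) = int d} = (d - 1) * (d - 2) div 2"
proof -
  let ?I = "{n :: 3 \<Rightarrow> int. (\<forall>j. n j \<ge> 1) \<and> (\<Sum>j\<in>UNIV. n j) = int d}"
  define T where "T = (SIGMA a:{..<d - 2}. {..<d - 2 - a})"
  \<comment> \<open>The first two entries are \<open>a + 1\<close> and \<open>b + 1\<close>, so the
    third is \<open>d - a - b - 2\<close>, and \<open>b < d - 2 - a\<close> says that it is at least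
    1.\<close>
  define f where "f = (\<lambda>(a, b) (j::3). if j = 1 then int a + 1 else if j = 2 then int b + 1 else int d - int a - int b - 2)"
  have "bij_betw f T ?I"
  proof (rule bij_betwI')
    show "(f x = f y) = (x = y)" for x y
      by (cases x; cases y) (auto simp: f_def fun_eq_iff forall_3)
    show "f x \<in> ?I" if "x \<in> T" for x
      using that by (auto simp: T_def f_def forall_3 sum_3)
    show "\<exists>x\<in>T. n = f x" if "n \<in> ?I" for n
      using that by (intro bexI[of _ "(nat (n 1 - 1), nat (n 2 - 1))"])
        (auto simp: T_def f_def fun_eq_iff forall_3 sum_3)
  qed
  moreover have "finite T" by (simp add: T_def)
  moreover have "card T = (d - 1) * (d - 2) div 2"
  proof -
    have "(\<Sum>a<k. k - a) = Suc k * k div 2" for k :: nat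
    proof -
      have "(\<Sum>a<k. k - a) = (\<Sum>a<k. Suc a)"
        by (rule sum.reindex_bij_witness[of _ "\<lambda>a. k - Suc a" "\<lambda>a. k - Suc a"]) auto
      also have "\<dots> = (\<Sum>a\<le>k. a)" by (induction k) auto
      also have "\<dots> = Suc k * k div 2" using gauss_sum_nat[of k] by (simp add: atMost_atLeast0 mult.commute)
      finally show ?thesis .
    qed
    moreover have "Suc (d - 2) * (d - 2) = (d - 1) * (d - 2)"
    proof (cases "d \<ge> 2")
      case True
      then have "Suc (d - 2) = d - 1" by simp
      then show ?thesis by (simp only:)
    qed simp
    moreover have "card T = (\<Sum>a<d - 2. d - 2 - a)" by (simp add: T_def)
    ultimately show ?thesis by metis
  qed
  ultimately show "finite ?I" "card ?I = (d - 1) * (d - 2) div 2"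
    using bij_betw_finite[of f T ?I] bij_betw_same_card[of f T ?I] by auto
qed

section \<open>The recursive family as homogeneous forms\<close>

lemma num3_simps [simp]: "(4::3) = 1" "(5::3) = 2"
  by simp_all

text \<open>Arithmetic in the type \<open>3\<close> is modulo 3. As the coefficients of
  \<open>q\<close> are cyclically symmetric, the coordinates \<open>k\<close>, \<open>k + 1\<close>,
  \<open>k + 2\<close> allow one argument for all three edges.\<close>

lemma cyclic_3:
  fixes j k :: 3
  shows "j = k \<or> j = k + 1 \<or> j = k + 2" "k \<noteq> k + 1" "k \<noteq> k + 2" "k + 1 \<noteq> k + 2"
  using exhaust_3[of j] exhaust_3[of k] by auto

lemma sum_cyclic_3: "(\<Sum>j\<in>UNIV. f j) = f k + f (k + 1) + f (k + 2)" for k :: 3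
  using exhaust_3[of k] by (auto simp: sum_3 add_ac)

lemma homogeneous_form_const: "homogeneous_form (\<lambda>_. c) 0"
  by unfold_locales (auto intro: exI[of _ "[:c:]"])

lemma homogeneous_form_coord: "homogeneous_form (\<lambda>z::complex^'n. z $ i) 1"
proof
  show "continuous_on UNIV (\<lambda>z. z $ i)" by (intro continuous_on_component continuous_on_id)
  show "\<exists>P. \<forall>w. (\<chi> j. z$j * w ^ m j) $ i = poly P w" for z :: "complex^'n" and m :: "'n \<Rightarrow> nat"
    by (intro exI[of _ "monom (z$i) (m i)"]) (simp add: poly_monom)
qed simp

lemma homogeneous_form_mult:
  assumes "homogeneous_form f d" "homogeneous_form g e"
  shows "homogeneous_form (\<lambda>z. f z * g z) (d + e)"
proof -
  interpret f: homogeneous_form f d by fact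
  interpret g: homogeneous_form g e by fact
  show ?thesis
  proof
    show "continuous_on UNIV (\<lambda>z. f z * g z)" by (intro continuous_intros f.cont g.cont)
    show "f (c *s z) * g (c *s z) = c ^ (d + e) * (f z * g z)" for c z
      by (simp add: f.homogeneous g.homogeneous power_add)
    show "\<exists>P. \<forall>w. f (\<chi> j. z$j * w ^ m j) * g (\<chi> j. z$j * w ^ m j) = poly P w" for z m
      using f.monomial_curve[of z m] g.monomial_curve[of z m] by (metis poly_mult)
  qed
qed

lemma homogeneous_form_power: "homogeneous_form f d \<Longrightarrow> homogeneous_form (\<lambda>z. f z ^ k) (k * d)"
  by (induction k) (auto intro: homogeneous_form_const homogeneous_form_mult)

lemma homogeneous_form_add:
  assumes "homogeneous_form f d" "homogeneous_form g d"
  shows "homogeneous_form (\<lambda>z. f z + g z) d"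
proof -
  interpret f: homogeneous_form f d by fact
  interpret g: homogeneous_form g d by fact
  show ?thesis
  proof
    show "continuous_on UNIV (\<lambda>z. f z + g z)" by (intro continuous_intros f.cont g.cont)
    show "f (c *s z) + g (c *s z) = c ^ d * (f z + g z)" for c z
      by (simp add: f.homogeneous g.homogeneous distrib_left)
    show "\<exists>P. \<forall>w. f (\<chi> j. z$j * w ^ m j) + g (\<chi> j. z$j * w ^ m j) = poly P w" for z m
      using f.monomial_curve[of z m] g.monomial_curve[of z m] by (metis poly_add)
  qed
qed

lemma homogeneous_form_zero: "homogeneous_form (\<lambda>_. 0) d"
  by unfold_locales (auto intro: exI[of _ 0])

lemma homogeneous_form_sum:
  "finite A \<Longrightarrow> (\<And>a. a \<in> A \<Longrightarrow> homogeneous_form (f a) d) \<Longrightarrow> homogeneous_form (\<lambda>z. \<Sum>a\<in>A. f a z) d"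
  by (induction A rule: finite_induct) (auto intro: homogeneous_form_zero homogeneous_form_add)

lemma finite_bdry_exps: "finite (bdry_exps n)"
  by (rule finite_subset[of _ "{..n} \<times> {..n} \<times> {..n}"]) (auto simp: bdry_exps_def)

lemma homogeneous_form_qpoly: "homogeneous_form (qpoly t n) n"
proof (cases "n = 0")
  case True
  then show ?thesis using homogeneous_form_const[of 1] by (simp add: qpoly_def[abs_def])
next
  case False
  have "homogeneous_form (\<lambda>z. \<Sum>I\<in>bdry_exps n. of_real (qcoef t n I) * z$1 ^ fst I * z$2 ^ fst (snd I) * z$3 ^ snd (snd I)) n"
  proof (rule homogeneous_form_sum[OF finite_bdry_exps])
    fix I assume "I \<in> bdry_exps n"
    \<comment> \<open>The degree is written in the shape that the rules for products and powers
      produce.\<close>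
    then have "n = 0 + fst I * 1 + fst (snd I) * 1 + snd (snd I) * 1" by (auto simp: bdry_exps_def)
    moreover have "homogeneous_form (\<lambda>z. of_real (qcoef t n I) * z$1 ^ fst I * z$2 ^ fst (snd I) * z$3 ^ snd (snd I))
        (0 + fst I * 1 + fst (snd I) * 1 + snd (snd I) * 1)"
      by (intro homogeneous_form_mult homogeneous_form_const homogeneous_form_power homogeneous_form_coord)
    ultimately show "homogeneous_form (\<lambda>z. of_real (qcoef t n I) * z$1 ^ fst I * z$2 ^ fst (snd I) * z$3 ^ snd (snd I)) n"
      by simp
  qed
  then show ?thesis using False by (simp add: qpoly_def[abs_def] case_prod_beta)
qed

lemma ppoly_less_3: "n < 3 \<Longrightarrow> ppoly t b n = qpoly t n"
proof -
  assume "n < 3"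
  then have "n = 0 \<or> n = Suc 0 \<or> n = Suc (Suc 0)" by auto
  then show ?thesis by (auto simp: fun_eq_iff qpoly_def numeral_2_eq_2)
qed

lemma ppoly_add_3: "ppoly t b (n + 3) = (\<lambda>z. qpoly t (n + 3) z + of_real (b (n + 3)) * z$1 * z$2 * z$3 * ppoly t b n z)"
  using ppoly.simps(4)[of t b n] by (simp add: fun_eq_iff numeral_3_eq_3)

lemma step_3_induct [case_names less step]:
  assumes "\<And>n::nat. n < 3 \<Longrightarrow> P n" "\<And>n. P n \<Longrightarrow> P (n + 3)"
  shows "P n"
proof (induction n rule: less_induct)
  case (less n)
  show ?case
  proof (cases "n < 3")
    case False
    then show ?thesis using assms(2)[of "n - 3"] less[of "n - 3"] by simp
  qed (rule assms(1))
qed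

lemma homogeneous_form_ppoly: "homogeneous_form (ppoly t b n) n"
proof (induction n rule: step_3_induct)
  case (less n)
  then show ?case by (simp add: ppoly_less_3 homogeneous_form_qpoly)
next
  case (step n)
  have "homogeneous_form (\<lambda>z. of_real (b (n + 3)) * z$1 * z$2 * z$3 * ppoly t b n z) (0 + 1 + 1 + 1 + n)"
    by (intro homogeneous_form_mult homogeneous_form_const homogeneous_form_coord step)
  then show ?case unfolding ppoly_add_3
    by (intro homogeneous_form_add homogeneous_form_qpoly) (simp add: numeral_3_eq_3)
qed

lemma ppoly_cong:
  "(\<And>j. j \<le> n \<Longrightarrow> j mod 3 = n mod 3 \<Longrightarrow> b j = b' j) \<Longrightarrow> ppoly t b n = ppoly t b' n"
  by (induction n rule: step_3_induct) (simp_all add: ppoly_less_3 ppoly_add_3)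

section \<open>Restriction to the edges\<close>

text \<open>The vanishing of the higher coefficients is carried along so that the sum for
  \<open>A\<close> can be extended by one term in the induction step.\<close>

lemma prod_linear_forms:
  fixes x y :: complex and u :: "'a \<Rightarrow> real"
  assumes "finite A"
  shows "(\<Prod>j\<in>A. x + of_real (u j) * y) =
    (\<Sum>i\<le>card A. of_real (coeff (\<Prod>j\<in>A. [:1, u j:]) i) * x ^ (card A - i) * y ^ i)
    \<and> (\<forall>i > card A. coeff (\<Prod>j\<in>A. [:1, u j:]) i = 0)"
  using assms
proof (induction A rule: finite_induct)
  case empty
  show ?case by (auto simp: coeff_eq_0)
next
  case (insert a A)
  define Q where "Q = (\<Prod>j\<in>A. [:1, u j:])"
  define n where "n = card A"
  have IH: "(\<Prod>j\<in>A. x + of_real (u j) * y) = (\<Sum>i\<le>n. of_real (coeff Q i) * x ^ (n - i) * y ^ i)"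
    and Q0: "\<And>i. i > n \<Longrightarrow> coeff Q i = 0" using insert by (auto simp: Q_def n_def)
  have R: "(\<Prod>j\<in>insert a A. [:1, u j:]) = Q + pCons 0 (smult (u a) Q)" using insert by (simp add: Q_def)
  have card: "card (insert a A) = Suc n" using insert by (simp add: n_def)
  have 1: "(\<Sum>i\<le>Suc n. of_real (coeff Q i) * x ^ (Suc n - i) * y ^ i) = x * (\<Sum>i\<le>n. of_real (coeff Q i) * x ^ (n - i) * y ^ i)"
    by (simp add: Q0 sum_distrib_left Suc_diff_le mult_ac)
  have 2: "(\<Sum>i\<le>Suc n. of_real (coeff (pCons 0 (smult (u a) Q)) i) * x ^ (Suc n - i) * y ^ i)
      = of_real (u a) * y * (\<Sum>i\<le>n. of_real (coeff Q i) * x ^ (n - i) * y ^ i)"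
    by (subst sum.atMost_Suc_shift) (simp add: sum_distrib_left mult_ac)
  have "(\<Prod>j\<in>insert a A. x + of_real (u j) * y) = (\<Sum>i\<le>Suc n. of_real (coeff Q i) * x ^ (Suc n - i) * y ^ i)
      + (\<Sum>i\<le>Suc n. of_real (coeff (pCons 0 (smult (u a) Q)) i) * x ^ (Suc n - i) * y ^ i)"
    unfolding 1 2 IH[symmetric] using insert by (simp add: algebra_simps)
  also have "\<dots> = (\<Sum>i\<le>Suc n. of_real (coeff (Q + pCons 0 (smult (u a) Q)) i) * x ^ (Suc n - i) * y ^ i)"
    unfolding sum.distrib[symmetric] by (simp add: algebra_simps)
  finally show ?case unfolding R card using Q0 by (auto simp: coeff_pCons split: nat.split)
qed

lemma prod_beta:
  fixes x y :: complex
  shows "(\<Prod>j\<in>{1..n}. x + of_real (t n j) * y) = (\<Sum>i\<le>n. of_real (beta t n i) * x ^ (n - i) * y ^ i)"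
  using prod_linear_forms[of "{1..n}" x "t n" y] by (simp add: beta_def)

lemma beta_0: "beta t n 0 = 1"
  unfolding beta_def poly_0_coeff_0[symmetric] by (simp add: poly_prod)

lemma beta_top: "beta t n n = (\<Prod>j\<in>{1..n}. t n j)"
proof -
  have "(\<Prod>j\<in>{1..n}. 0 + of_real (t n j) * 1) = (\<Sum>i\<le>n. of_real (beta t n i) * 0 ^ (n - i) * 1 ^ i :: complex)"
    by (rule prod_beta)
  also have "\<dots> = (\<Sum>i\<le>n. if i = n then of_real (beta t n i) else 0)"
    by (intro sum.cong) auto
  finally have "complex_of_real (\<Prod>j\<in>{1..n}. t n j) = of_real (beta t n n)" by simp
  then show ?thesis by (simp only: of_real_eq_iff)
qed

definition reciprocal :: "(nat \<Rightarrow> nat \<Rightarrow> real) \<Rightarrow> nat \<Rightarrow> bool" where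
  "reciprocal t n \<longleftrightarrow> (\<forall>i\<in>{1..n}. t n i > 0 \<and> t n (n - i + 1) = 1 / t n i) \<and> inj_on (t n) {1..n}"

text \<open>Reversing the indices shows that the product of the \<open>t n j\<close> is its own
  reciprocal, and it is positive.\<close>

lemma reciprocal_beta_top:
  assumes "reciprocal t n"
  shows "beta t n n = 1"
proof -
  let ?T = "\<Prod>j\<in>{1..n}. t n j"
  have "?T = (\<Prod>j\<in>{1..n}. t n (n - j + 1))"
    by (rule prod.reindex_bij_witness[of _ "\<lambda>j. n - j + 1" "\<lambda>j. n - j + 1"]) auto
  also have "\<dots> = (\<Prod>j\<in>{1..n}. 1 / t n j)" using assms by (intro prod.cong) (auto simp: reciprocal_def)
  also have "\<dots> = 1 / ?T" by (simp add: prod_dividef)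
  finally have "?T = 1 / ?T" .
  moreover have "?T > 0" using assms by (intro prod_pos) (auto simp: reciprocal_def)
  ultimately have "?T * ?T = 1" by (metis less_irrefl nonzero_eq_divide_eq)
  then show ?thesis unfolding beta_top using \<open>?T > 0\<close> by (auto simp: square_eq_1_iff)
qed

text \<open>Only monomials without \<open>z$k\<close> survive. A vertex belongs to two edges while
  \<open>qcoef\<close> uses the formula of one of them; both give 1, since the two end coefficients
  of the binary form are 1.\<close>

lemma qpoly_edge:
  assumes "reciprocal t n" "z$k = 0"
  shows "qpoly t n z = (\<Prod>j\<in>{1..n}. z$(k+1) + of_real (t n j) * z$(k+2))"
proof (cases "n = 0")
  case True
  then show ?thesis by (simp add: qpoly_def)
next
  case n: False
  note b = beta_0[of t n] reciprocal_beta_top[OF assms(1)]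
  define F where "F = (\<lambda>(i1, i2, i3). of_real (qcoef t n (i1, i2, i3)) * z$1 ^ i1 * z$2 ^ i2 * z$3 ^ i3)"
  have q: "qpoly t n z = (\<Sum>I\<in>bdry_exps n. F I)" using n by (simp add: qpoly_def F_def)
  have reduce: "qpoly t n z = (\<Sum>i\<le>n. F (h i))"
    if "inj_on h {..n}" "\<And>i. i \<le> n \<Longrightarrow> h i \<in> bdry_exps n" "\<And>I. I \<in> bdry_exps n \<Longrightarrow> I \<notin> h ` {..n} \<Longrightarrow> F I = 0" for h
  proof -
    have "(\<Sum>I\<in>bdry_exps n. F I) = (\<Sum>I\<in>h ` {..n}. F I)"
      using that by (intro sum.mono_neutral_right finite_bdry_exps) auto
    then show ?thesis using that(1) by (simp add: q sum.reindex)
  qed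
  consider "k = 1" | "k = 2" | "k = 3" using exhaust_3 by blast
  then show ?thesis
  proof cases
    case 1
    have "qpoly t n z = (\<Sum>i\<le>n. F (0, n - i, i))"
    proof (rule reduce)
      fix I assume I: "I \<in> bdry_exps n" "I \<notin> (\<lambda>i. (0, n - i, i)) ` {..n}"
      obtain i1 i2 i3 where [simp]: "I = (i1, i2, i3)" by (cases I)
      have "i1 \<noteq> 0"
      proof
        assume "i1 = 0"
        then have "I = (0, n - i3, i3)" "i3 \<le> n" using I(1) by (auto simp: bdry_exps_def)
        then show False using I(2) by blast
      qed
      then show "F I = 0" using assms(2) 1 by (simp add: F_def)
    qed (auto simp: inj_on_def bdry_exps_def)
    also have "\<dots> = (\<Sum>i\<le>n. of_real (beta t n i) * z$2 ^ (n - i) * z$3 ^ i)"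
      using b by (intro sum.cong) (auto simp: F_def qcoef_def)
    finally show ?thesis using 1 prod_beta[of "z$2" t n "z$3"] by simp
  next
    case 2
    have "qpoly t n z = (\<Sum>i\<le>n. F (i, 0, n - i))"
    proof (rule reduce)
      fix I assume I: "I \<in> bdry_exps n" "I \<notin> (\<lambda>i. (i, 0, n - i)) ` {..n}"
      obtain i1 i2 i3 where [simp]: "I = (i1, i2, i3)" by (cases I)
      have "i2 \<noteq> 0"
      proof
        assume "i2 = 0"
        then have "I = (i1, 0, n - i1)" "i1 \<le> n" using I(1) by (auto simp: bdry_exps_def)
        then show False using I(2) by blast
      qed
      then show "F I = 0" using assms(2) 2 by (simp add: F_def)
    qed (auto simp: inj_on_def bdry_exps_def)
    also have "\<dots> = (\<Sum>i\<le>n. of_real (beta t n i) * z$3 ^ (n - i) * z$1 ^ i)"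
    proof (intro sum.cong refl)
      fix i assume "i \<in> {..n}"
      then have "qcoef t n (i, 0, n - i) = beta t n i"
        using b n by (cases "i = n"; cases "i = 0") (auto simp: qcoef_def)
      then show "F (i, 0, n - i) = of_real (beta t n i) * z$3 ^ (n - i) * z$1 ^ i" by (simp add: F_def)
    qed
    finally show ?thesis using 2 prod_beta[of "z$3" t n "z$1"] by simp
  next
    case 3
    have "qpoly t n z = (\<Sum>i\<le>n. F (n - i, i, 0))"
    proof (rule reduce)
      fix I assume I: "I \<in> bdry_exps n" "I \<notin> (\<lambda>i. (n - i, i, 0)) ` {..n}"
      obtain i1 i2 i3 where [simp]: "I = (i1, i2, i3)" by (cases I)
      have "i3 \<noteq> 0"
      proof
        assume "i3 = 0"
        then have "I = (n - i2, i2, 0)" "i2 \<le> n" using I(1) by (auto simp: bdry_exps_def)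
        then show False using I(2) by blast
      qed
      then show "F I = 0" using assms(2) 3 by (simp add: F_def)
    qed (auto simp: inj_on_def bdry_exps_def)
    also have "\<dots> = (\<Sum>i\<le>n. of_real (beta t n i) * z$1 ^ (n - i) * z$2 ^ i)"
      by (intro sum.cong) (auto simp: F_def qcoef_def)
    finally show ?thesis using 3 prod_beta[of "z$1" t n "z$2"] by simp
  qed
qed

text \<open>The recursive term contains the factor \<open>z$1 * z$2 * z$3\<close>, which vanishes on
  every edge.\<close>

lemma ppoly_edge:
  assumes "reciprocal t n" "z$k = 0"
  shows "ppoly t b n z = (\<Prod>j\<in>{1..n}. z$(k+1) + of_real (t n j) * z$(k+2))"
proof -
  have "ppoly t b n z = qpoly t n z"
  proof (cases "n < 3")
    case False
    then have "ppoly t b n z = qpoly t n z + of_real (b n) * z$1 * z$2 * z$3 * ppoly t b (n - 3) z"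
      using ppoly_add_3[of t b "n - 3"] by simp
    moreover have "of_real (b n) * z$1 * z$2 * z$3 * ppoly t b (n - 3) z = 0"
      using assms(2) exhaust_3[of k] by auto
    ultimately show ?thesis by simp
  qed (simp add: ppoly_less_3)
  then show ?thesis using qpoly_edge[OF assms] by simp
qed

text \<open>At a nonnegative real point of an edge each linear factor is positive, because its
  coefficients 1 and \<open>t n j\<close> are.\<close>

lemma plane_curve_ppoly:
  assumes "reciprocal t n"
  shows "plane_curve (ppoly t b n) n"
proof -
  interpret homogeneous_form "ppoly t b n" n by (rule homogeneous_form_ppoly)
  show ?thesis
  proof
    fix \<rho> :: "real^3" and k assume \<rho>: "\<And>j. \<rho>$j \<ge> 0" "\<rho> \<noteq> 0" "\<rho>$k = 0"
    have "\<rho>$(k+1) \<noteq> 0 \<or> \<rho>$(k+2) \<noteq> 0"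
      using \<rho>(2,3) cyclic_3(1)[of _ k] by (metis vec_eq_iff zero_index)
    then have "\<rho>$(k+1) + u * \<rho>$(k+2) > 0" if "u > 0" for u
      using \<rho>(1) that by (metis add_nonneg_pos add_pos_nonneg mult_nonneg_nonneg mult_pos_pos less_eq_real_def)
    then have "\<rho>$(k+1) + t n j * \<rho>$(k+2) \<noteq> 0" if "j \<in> {1..n}" for j
      using assms that unfolding reciprocal_def by (metis less_irrefl)
    then have "(\<Prod>j\<in>{1..n}. complex_of_real (\<rho>$(k+1) + t n j * \<rho>$(k+2))) \<noteq> 0"
      by (simp only: prod_zero_iff finite_atLeastAtMost of_real_eq_0_iff) blast
    then show "ppoly t b n (torus_pt \<rho> 0) \<noteq> 0"
      using ppoly_edge[OF assms, of "torus_pt \<rho> 0" k b] \<rho>(3) by simp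
  qed
qed

text \<open>The j-th linear factor vanishes exactly where the remaining coordinates have quotient
  \<open>- t n j\<close>, so it contributes one point of the edge; distinct \<open>t n j\<close>
  give distinct points.\<close>

lemma ppoly_edge_points:
  assumes "reciprocal t n"
  shows "finite (momentF ` curve (ppoly t b n) \<inter> simplex2_edge k)"
    and "card (momentF ` curve (ppoly t b n) \<inter> simplex2_edge k) = n"
proof -
  interpret plane_curve "ppoly t b n" n by (rule plane_curve_ppoly[OF assms])
  note c3 = cyclic_3(2,3,4)[of k] cyclic_3(2,3,4)[of k, symmetric]
  define \<rho> :: "nat \<Rightarrow> real^3" where "\<rho> j = (\<chi> i. if i = k then 0 else if i = k + 1 then t n j else 1)" for j
  have \<rho>: "\<rho> j $ k = 0" "\<rho> j $ (k+1) = t n j" "\<rho> j $ (k+2) = 1" for j using c3 by (auto simp: \<rho>_def)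
  have \<rho>0: "\<rho> j \<noteq> 0" for j using \<rho>(3)[of j] by (metis zero_index zero_neq_one)
  have pos: "t n j > 0" if "j \<in> {1..n}" for j using assms that by (simp add: reciprocal_def)
  have \<rho>nn: "\<rho> j $ i \<ge> 0" if "j \<in> {1..n}" for i j using pos[OF that] by (simp add: \<rho>_def)
  let ?S = "momentF ` curve (ppoly t b n) \<inter> simplex2_edge k"
  have "bij_betw (\<lambda>j. amoeba_pt (\<rho> j)) {1..n} ?S"
  proof (rule bij_betwI')
    fix j j' assume j: "j \<in> {1..n}" "j' \<in> {1..n}"
    show "amoeba_pt (\<rho> j) = amoeba_pt (\<rho> j') \<longleftrightarrow> j = j'"
    proof
      assume *: "amoeba_pt (\<rho> j) = amoeba_pt (\<rho> j')"
      have r: "amoeba_pt (\<rho> j) $ (k+1) / amoeba_pt (\<rho> j) $ (k+2) = (t n j)\<^sup>2" for j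
        using \<rho>0[of j] by (simp add: amoeba_pt_nth \<rho> power_divide)
      have "(t n j)\<^sup>2 = (t n j')\<^sup>2" using r[of j] r[of j'] * by simp
      then have "t n j = t n j'" using pos j by (simp add: power2_eq_iff_nonneg less_imp_le)
      then show "j = j'" using assms j by (auto simp: reciprocal_def dest: inj_onD)
    qed simp
  next
    fix j assume j: "j \<in> {1..n}"
    \<comment> \<open>The angle \<pi> supplies the sign that makes the j-th factor vanish.\<close>
    let ?z = "torus_pt (\<rho> j) (\<chi> i. if i = k + 1 then pi else 0)"
    have "?z $ (k+1) + of_real (t n j) * ?z $ (k+2) = 0" using c3 by (simp add: \<rho>)
    then have "(\<Prod>j\<in>{1..n}. ?z $ (k+1) + of_real (t n j) * ?z $ (k+2)) = 0"
      by (intro prod_zero bexI[OF _ j]) auto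
    then have "ppoly t b n ?z = 0"
      by (subst ppoly_edge[OF assms, of _ k]) (simp_all only: torus_pt_nth \<rho>(1) of_real_0 mult_zero_left)
    then show "amoeba_pt (\<rho> j) \<in> ?S"
      using amoeba_pt_mem_image[OF \<rho>nn[OF j] \<rho>0] amoeba_pt_simplex[OF \<rho>0]
      by (auto simp: simplex2_edge_def amoeba_pt_nth \<rho>)
  next
    fix r assume "r \<in> ?S"
    then obtain z where z: "z \<noteq> 0" "ppoly t b n z = 0" "r = momentF z" "r$k = 0"
      by (auto simp: curve_def simplex2_edge_def)
    define c where "c = (\<chi> i. cmod (z$i))"
    have r: "r = amoeba_pt c" by (simp add: z(3) momentF_def amoeba_pt_def c_def)
    have "c \<noteq> 0" using z(1) by (simp add: c_def vec_eq_iff)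
    then have zk: "z$k = 0" using z(4) by (simp add: r amoeba_pt_nth) (simp add: c_def)
    then obtain j where j: "j \<in> {1..n}" "z$(k+1) + of_real (t n j) * z$(k+2) = 0"
      using z(2) ppoly_edge[OF assms zk] by (auto simp: prod_zero_iff)
    then have e: "z$(k+1) = - (of_real (t n j) * z$(k+2))" by (simp add: eq_neg_iff_add_eq_0)
    have "z$(k+2) \<noteq> 0"
    proof
      assume "z$(k+2) = 0"
      then have "z$i = 0" for i using cyclic_3(1)[of i k] e zk by auto
      then show False using z(1) by (simp add: vec_eq_iff)
    qed
    have "c $ i = (cmod (z$(k+2)) *\<^sub>R \<rho> j) $ i" for i
      using cyclic_3(1)[of i k] pos[OF j(1)] by (auto simp: c_def \<rho> zk e norm_mult)
    then have "c = cmod (z$(k+2)) *\<^sub>R \<rho> j" by (simp add: vec_eq_iff)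
    then have "r = amoeba_pt (\<rho> j)" using \<open>z$(k+2) \<noteq> 0\<close> by (simp add: r amoeba_pt_scaleR)
    then show "\<exists>j\<in>{1..n}. r = amoeba_pt (\<rho> j)" using j by blast
  qed
  then show "finite ?S" "card ?S = n"
    using bij_betw_finite[of _ "{1..n}" ?S] bij_betw_same_card[of _ "{1..n}" ?S] by auto
qed

section \<open>Realising all orders and choosing the thresholds\<close>

lemma separate_finite_set:
  fixes T :: "real set"
  assumes "finite T" "\<And>y. y \<in> T \<Longrightarrow> y > 0" "a \<le> card T"
  shows "\<exists>x>0. x \<notin> T \<and> card {y \<in> T. y < x} = a"
  using assms(3)
proof (induction a)
  case 0
  \<comment> \<open>The element 1 is a default for empty \<open>T\<close>.\<close>
  define x where "x = Min (insert 1 T) / 2"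
  have "Min (insert 1 T) > 0" using assms by (simp add: Min_gr_iff)
  moreover have "Min (insert 1 T) \<le> y" if "y \<in> T" for y using assms(1) that by simp
  ultimately have "x > 0" "\<And>y. y \<in> T \<Longrightarrow> x < y" by (fastforce simp: x_def)+
  then show ?case by (intro exI[of _ x]) (auto simp: card_eq_0_iff dest: less_asym)
next
  case (Suc a)
  then obtain x where x: "x > 0" "x \<notin> T" "card {y \<in> T. y < x} = a" by auto
  define D where "D = {y \<in> T. x < y}"
  have fin: "finite D" using assms(1) by (simp add: D_def)
  have "D \<noteq> {}"
  proof
    assume "D = {}"
    then have "{y \<in> T. y < x} = T" using x(2) by (force simp: D_def not_less_iff_gr_or_eq)
    then show False using x(3) Suc.prems by simp
  qed
  define m where "m = Min D"
  have m: "m \<in> D" "\<And>y. y \<in> D \<Longrightarrow> m \<le> y" using fin \<open>D \<noteq> {}\<close> by (auto simp: m_def)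
  \<comment> \<open>\<open>M\<close> is the successor of \<open>m\<close> in \<open>D\<close> if it
    is at most \<open>m + 1\<close>, and \<open>m + 1\<close> otherwise, in particular when
    \<open>m\<close> is the largest element.\<close>
  define M where "M = Min (insert (m + 1) (D - {m}))"
  have M: "m < M" "\<And>y. y \<in> D \<Longrightarrow> y \<noteq> m \<Longrightarrow> M \<le> y"
    using fin m by (auto simp: M_def Min_gr_iff order_le_less[of m] intro!: Min_le)
  define x' where "x' = (m + M) / 2"
  have x': "m < x'" "x' < M" using M(1) by (auto simp: x'_def)
  have "{y \<in> T. y < x'} = insert m {y \<in> T. y < x}"
  proof (intro set_eqI iffI)
    fix y assume "y \<in> {y \<in> T. y < x'}"
    then have y: "y \<in> T" "y < x'" by auto
    show "y \<in> insert m {y \<in> T. y < x}"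
    proof (rule ccontr)
      assume "y \<notin> insert m {y \<in> T. y < x}"
      then have "y \<noteq> m" "y \<in> D" using y x(2) by (auto simp: D_def not_less order_le_less)
      then show False using M(2)[of y] x' y by simp
    qed
  next
    fix y assume "y \<in> insert m {y \<in> T. y < x}"
    then show "y \<in> {y \<in> T. y < x'}" using m(1) x' by (auto simp: D_def)
  qed
  moreover have "m \<notin> {y \<in> T. y < x}" using m(1) by (auto simp: D_def)
  ultimately have "card {y \<in> T. y < x'} = Suc a" using assms(1) x(3) by simp
  moreover have "x' \<notin> T"
  proof
    assume "x' \<in> T"
    then have "x' \<in> D" "x' \<noteq> m" using x' m(1) by (auto simp: D_def)
    then show False using M(2) x' by fastforce
  qed
  moreover have "x' > 0" using x' m(1) x(1) by (auto simp: D_def)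
  ultimately show ?case by blast
qed

text \<open>The induction invariant includes orders with zero entries: a positive order in degree
  \<open>n + 3\<close> minus (1,1,1) is an arbitrary nonnegative order in degree
  \<open>n\<close>.\<close>

definition realizes_orders :: "(nat \<Rightarrow> nat \<Rightarrow> real) \<Rightarrow> (nat \<Rightarrow> real) \<Rightarrow> nat \<Rightarrow> bool" where
  "realizes_orders t b n \<longleftrightarrow> (\<forall>\<nu>. (\<forall>j. \<nu> j \<ge> 0) \<and> (\<Sum>j\<in>UNIV. \<nu> j) = int n \<longrightarrow>
     (\<exists>\<rho>. (\<forall>j. \<rho>$j > 0) \<and> torus_order (ppoly t b n) \<rho> \<nu>))"

text \<open>On the edge, the ratio \<open>x\<close> of the two radii is put in a gap between the
  \<open>t n j\<close> such that the term with \<open>z$(k+1)\<close> dominates in exactly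
  \<open>\<nu> (k+1)\<close> linear factors and the other term in the rest. The order found on this
  degenerate torus persists when the k-th radius becomes slightly positive.\<close>

lemma boundary_order_realized:
  assumes t: "reciprocal t n" and \<nu>: "\<And>j. \<nu> j \<ge> 0" "(\<Sum>j\<in>UNIV. \<nu> j) = int n" "\<nu> k = 0"
  shows "\<exists>\<rho>. (\<forall>j. \<rho>$j > 0) \<and> torus_order (ppoly t b n) \<rho> \<nu>"
proof -
  interpret plane_curve "ppoly t b n" n by (rule plane_curve_ppoly[OF t])
  note c3 = cyclic_3(2,3,4)[of k] cyclic_3(2,3,4)[of k, symmetric]
  have pos: "t n j > 0" if "j \<in> {1..n}" for j using t that by (simp add: reciprocal_def)
  have inj: "inj_on (t n) {1..n}" using t by (simp add: reciprocal_def)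
  have sum: "\<nu> (k+1) + \<nu> (k+2) = int n" using \<nu>(2,3) by (simp add: sum_cyclic_3[of _ k])
  have "nat (\<nu> (k+1)) \<le> card (t n ` {1..n})"
    using sum \<nu>(1)[of "k+2"] unfolding card_image[OF inj] by simp
  then obtain x where x: "x > 0" "x \<notin> t n ` {1..n}" "card {y \<in> t n ` {1..n}. y < x} = nat (\<nu> (k+1))"
    using separate_finite_set[of "t n ` {1..n}"] pos by blast
  define J where "J = {j \<in> {1..n}. t n j < x}"
  have "{y \<in> t n ` {1..n}. y < x} = t n ` J" by (auto simp: J_def)
  moreover have "inj_on (t n) J" using inj by (rule inj_on_subset) (auto simp: J_def)
  ultimately have cardJ: "int (card J) = \<nu> (k+1)" using x(3) \<nu>(1)[of "k+1"] by (simp add: card_image)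
  define \<rho> :: "real \<Rightarrow> real^3" where "\<rho> s = (\<chi> i. if i = k then s else if i = k + 1 then x else 1)" for s
  have \<rho>: "\<rho> s $ k = s" "\<rho> s $ (k+1) = x" "\<rho> s $ (k+2) = 1" for s using c3 by (auto simp: \<rho>_def)
  \<comment> \<open>\<open>\<mu> j\<close> is the order of the j-th linear factor, that is, of its
    dominant term.\<close>
  define \<mu> where "\<mu> j i = (if j \<in> J then if i = k + 1 then 1 else 0 else if i = k + 2 then 1 else (0::int))" for j and i :: 3
  have cc: "continuous_on UNIV (\<lambda>z::complex^3. z$i)" for i by (intro continuous_on_component continuous_on_id)
  have factor: "torus_order (\<lambda>z. z$(k+1) + of_real (t n j) * z$(k+2)) (\<rho> 0) (\<mu> j)" if j: "j \<in> {1..n}" for j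
  proof (cases "t n j < x")
    case True
    have "torus_order (\<lambda>z. z$(k+1)) (\<rho> 0) (\<lambda>i. if i = k + 1 then 1 else 0)"
      by (rule torus_order_coord) (simp add: \<rho> x)
    then have "torus_order (\<lambda>z. z$(k+1) + of_real (t n j) * z$(k+2)) (\<rho> 0) (\<lambda>i. if i = k + 1 then 1 else 0)"
      by (rule torus_order_rouche) (use True pos[OF j] x in \<open>auto intro!: continuous_intros cc simp: \<rho> norm_mult\<close>)
    moreover have "\<mu> j = (\<lambda>i. if i = k + 1 then 1 else 0)" using True j by (auto simp: \<mu>_def J_def)
    ultimately show ?thesis by simp
  next
    case False
    then have lt: "x < t n j" using x(2) j by (metis image_eqI linorder_neqE_linordered_idom)
    have "torus_order (\<lambda>z. of_real (t n j) * z$(k+2)) (\<rho> 0) (\<lambda>i. 0 + (if i = k + 2 then 1 else 0))"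
      using pos[OF j] by (intro torus_order_mult torus_order_const torus_order_coord) (auto simp: \<rho>)
    then have "torus_order (\<lambda>z. z$(k+1) + of_real (t n j) * z$(k+2)) (\<rho> 0) (\<lambda>i. 0 + (if i = k + 2 then 1 else 0))"
      by (rule torus_order_rouche) (use lt pos[OF j] x in \<open>auto intro!: continuous_intros cc simp: \<rho> norm_mult\<close>)
    moreover have "\<mu> j = (\<lambda>i. 0 + (if i = k + 2 then 1 else 0))" using False by (auto simp: \<mu>_def J_def)
    ultimately show ?thesis by simp
  qed
  have sum_\<mu>: "(\<Sum>j\<in>{1..n}. \<mu> j i) = \<nu> i" for i
  proof -
    have J: "J \<subseteq> {1..n}" by (auto simp: J_def)
    have s: "(\<Sum>j\<in>{1..n}. if j \<in> J then a else c) = \<nu> (k+1) * a + \<nu> (k+2) * c" for a c :: int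
    proof -
      have "(\<Sum>j\<in>{1..n}. if j \<in> J then a else c) = (\<Sum>j\<in>{1..n} \<inter> J. a) + (\<Sum>j\<in>{1..n} - J. c)"
        by (simp add: sum.If_cases Diff_eq)
      also have "\<dots> = int (card J) * a + int (card ({1..n} - J)) * c"
        using J by (simp add: Int_absorb1)
      also have "int (card ({1..n} - J)) = \<nu> (k+2)"
        using cardJ sum card_mono[OF _ J] card_Diff_subset[OF finite_subset[OF J] J] by simp
      finally show ?thesis using cardJ by simp
    qed
    have "(\<Sum>j\<in>{1..n}. \<mu> j i) = \<nu> (k+1) * (if i = k + 1 then 1 else 0) + \<nu> (k+2) * (if i = k + 2 then 1 else 0)"
      unfolding \<mu>_def by (rule s)
    then show ?thesis using cyclic_3(1)[of i k] c3 \<nu>(3) by auto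
  qed
  have "torus_order (\<lambda>z. \<Prod>j\<in>{1..n}. z$(k+1) + of_real (t n j) * z$(k+2)) (\<rho> 0) (\<lambda>i. \<Sum>j\<in>{1..n}. \<mu> j i)"
    by (intro torus_order_prod finite_atLeastAtMost factor)
  then have "torus_order (\<lambda>z. \<Prod>j\<in>{1..n}. z$(k+1) + of_real (t n j) * z$(k+2)) (\<rho> 0) \<nu>"
    unfolding sum_\<mu> .
  then have "torus_order (ppoly t b n) (\<rho> 0) \<nu>"
    unfolding torus_order_def
    by (subst ppoly_edge[OF t, of _ k]) (simp_all only: torus_pt_nth \<rho>(1) of_real_0 mult_zero_left)
  moreover have "\<rho> 0 $ j \<ge> 0" for j using x(1) by (simp add: \<rho>_def)
  ultimately obtain \<delta> where \<delta>: "\<delta> > 0" "\<And>\<rho>'. dist \<rho>' (\<rho> 0) < \<delta> \<Longrightarrow> torus_order (ppoly t b n) \<rho>' \<nu>"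
    using torus_order_nearby[OF cont, of "\<rho> 0" \<nu>] by blast
  have "\<rho> (\<delta> / 2) - \<rho> 0 = (\<delta> / 2) *\<^sub>R axis k 1"
    by (simp add: vec_eq_iff \<rho>_def axis_def)
  then have "dist (\<rho> (\<delta> / 2)) (\<rho> 0) < \<delta>" using \<delta>(1) by (simp add: dist_norm)
  then show ?thesis using \<delta> x(1) by (intro exI[of _ "\<rho> (\<delta> / 2)"]) (auto simp: \<rho>_def)
qed

text \<open>On the torus \<open>q\<close> is bounded by \<open>M\<close>, while the product of the
  coordinates with \<open>p\<close> is at least \<open>R * e\<close> in modulus. For
  \<open>c > M / (R * e)\<close> Rouche applies, and each coordinate factor adds 1 to its own
  entry.\<close>

lemma dominated_order:
  fixes p q :: "complex^3 \<Rightarrow> complex"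
  assumes "continuous_on UNIV p" "continuous_on UNIV q" "torus_order p \<rho> n" "\<And>j. \<rho>$j > 0"
  shows "\<forall>\<^sub>F c in at_top. torus_order (\<lambda>z. q z + of_real c * z$1 * z$2 * z$3 * p z) \<rho> (\<lambda>j. n j + 1)"
proof -
  obtain e where e: "e > 0" "\<And>\<theta>. e \<le> cmod (p (torus_pt \<rho> \<theta>))"
    using torus_lower_bound[OF assms(1), of \<rho>] assms(3,4) torus_order_nonzero less_imp_le by metis
  have "compact (q ` cball 0 (norm \<rho>))"
    by (intro compact_continuous_image continuous_on_subset[OF assms(2)]) auto
  then have "bounded (q ` cball 0 (norm \<rho>))" by (rule compact_imp_bounded)
  then obtain M where "\<forall>x\<in>q ` cball 0 (norm \<rho>). cmod x \<le> M" unfolding bounded_iff by blast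
  then have M: "cmod (q z) \<le> M" if "norm z \<le> norm \<rho>" for z using that by simp
  define R where "R = \<rho>$1 * \<rho>$2 * \<rho>$3"
  have R: "R > 0" using assms(4) by (simp add: R_def)
  have "torus_order (\<lambda>z. q z + of_real c * z$1 * z$2 * z$3 * p z) \<rho> (\<lambda>j. n j + 1)"
    if c: "c > max 0 (M / (R * e))" for c
  proof -
    have "torus_order (\<lambda>z. of_real c * z$1 * z$2 * z$3 * p z) \<rho>
       (\<lambda>j. 0 + (if j = 1 then 1 else 0) + (if j = 2 then 1 else 0) + (if j = 3 then 1 else 0) + n j)"
      using c by (intro torus_order_mult torus_order_const torus_order_coord assms) auto
    moreover have "(\<lambda>j::3. 0 + (if j = 1 then 1 else 0) + (if j = 2 then 1 else 0) + (if j = 3 then 1 else 0) + n j) = (\<lambda>j. n j + 1)"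
      by (auto simp: fun_eq_iff forall_3)
    ultimately have o: "torus_order (\<lambda>z. of_real c * z$1 * z$2 * z$3 * p z) \<rho> (\<lambda>j. n j + 1)" by simp
    have cc: "continuous_on UNIV (\<lambda>z::complex^3. z$i)" for i by (intro continuous_on_component continuous_on_id)
    show ?thesis
    proof (rule torus_order_rouche[OF o])
      fix \<theta>
      let ?z = "torus_pt \<rho> \<theta>"
      have "cmod (q ?z) \<le> M" by (rule M) simp
      also have "M < c * (R * e)" using c R e(1) by (simp add: pos_divide_less_eq)
      also have "\<dots> \<le> c * (R * cmod (p ?z))" using c R e(2)[of \<theta>] by (intro mult_left_mono) auto
      also have "\<dots> = cmod (of_real c * ?z$1 * ?z$2 * ?z$3 * p ?z)"
        using c assms(4)[of 1] assms(4)[of 2] assms(4)[of 3] by (simp add: norm_mult R_def)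
      finally show "cmod (q ?z + of_real c * ?z$1 * ?z$2 * ?z$3 * p ?z - of_real c * ?z$1 * ?z$2 * ?z$3 * p ?z)
          < cmod (of_real c * ?z$1 * ?z$2 * ?z$3 * p ?z)" by simp
    qed (auto intro!: continuous_intros cc assms)
  qed
  then show ?thesis unfolding eventually_at_top_dense by blast
qed

text \<open>Each positive order has its own cutoff for \<open>c\<close>, and there are only finitely
  many of them; orders with a zero entry come from the edges for every \<open>c\<close>.\<close>

lemma realizes_orders_step:
  assumes "realizes_orders t b n" "reciprocal t (n + 3)"
  shows "\<forall>\<^sub>F c in at_top. realizes_orders t (b(n + 3 := c)) (n + 3)"
proof -
  interpret homogeneous_form "ppoly t b n" n by (rule homogeneous_form_ppoly)
  interpret q: homogeneous_form "qpoly t (n + 3)" "n + 3" by (rule homogeneous_form_qpoly)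
  let ?N = "{\<nu> :: 3 \<Rightarrow> int. (\<forall>j. \<nu> j \<ge> 1) \<and> (\<Sum>j\<in>UNIV. \<nu> j) = int (n + 3)}"
  have p: "ppoly t (b(n + 3 := c)) (n + 3) = (\<lambda>z. qpoly t (n + 3) z + of_real c * z$1 * z$2 * z$3 * ppoly t b n z)" for c
    using ppoly_cong[of n "b(n + 3 := c)" b t] by (simp add: ppoly_add_3)
  have "\<forall>\<^sub>F c in at_top. \<exists>\<rho>. (\<forall>j. \<rho>$j > 0) \<and> torus_order (ppoly t (b(n + 3 := c)) (n + 3)) \<rho> \<nu>" if \<nu>: "\<nu> \<in> ?N" for \<nu>
  proof -
    have "(\<Sum>j\<in>UNIV. \<nu> j - 1) = int n" using \<nu> by (simp add: sum_3)
    moreover have "\<nu> j - 1 \<ge> 0" for j using \<nu> by (simp only: mem_Collect_eq diff_ge_0_iff_ge)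
    ultimately obtain \<rho> where \<rho>: "\<And>j. \<rho>$j > 0" "torus_order (ppoly t b n) \<rho> (\<lambda>j. \<nu> j - 1)"
      using assms(1)[unfolded realizes_orders_def, rule_format, of "\<lambda>j. \<nu> j - 1"] by blast
    have "\<forall>\<^sub>F c in at_top. torus_order (ppoly t (b(n + 3 := c)) (n + 3)) \<rho> \<nu>"
      using dominated_order[OF cont q.cont \<rho>(2,1)] by (simp add: p)
    then show ?thesis using \<rho>(1) by (auto elim!: eventually_mono)
  qed
  then have "\<forall>\<^sub>F c in at_top. \<forall>\<nu>\<in>?N. \<exists>\<rho>. (\<forall>j. \<rho>$j > 0) \<and> torus_order (ppoly t (b(n + 3 := c)) (n + 3)) \<rho> \<nu>"
    by (intro eventually_ball_finite[OF card_positive_triples(1)] ballI)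
  then show ?thesis
  proof (rule eventually_mono)
    fix c assume *: "\<forall>\<nu>\<in>?N. \<exists>\<rho>. (\<forall>j. \<rho>$j > 0) \<and> torus_order (ppoly t (b(n + 3 := c)) (n + 3)) \<rho> \<nu>"
    show "realizes_orders t (b(n + 3 := c)) (n + 3)"
      unfolding realizes_orders_def
    proof (intro allI impI)
      fix \<nu> :: "3 \<Rightarrow> int" assume \<nu>: "(\<forall>j. \<nu> j \<ge> 0) \<and> (\<Sum>j\<in>UNIV. \<nu> j) = int (n + 3)"
      show "\<exists>\<rho>. (\<forall>j. \<rho>$j > 0) \<and> torus_order (ppoly t (b(n + 3 := c)) (n + 3)) \<rho> \<nu>"
      proof (cases "\<exists>k. \<nu> k = 0")
        case True
        then show ?thesis using boundary_order_realized[OF assms(2)] \<nu> by blast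
      next
        case False
        have "\<nu> j \<ge> 1" for j using False \<nu> by (smt (verit))
        then show ?thesis using * \<nu> by blast
      qed
    qed
  qed
qed

text \<open>Three positive entries would have sum at least 3, so every order comes from an
  edge.\<close>

lemma realizes_orders_less_3:
  assumes "n < 3" "reciprocal t n"
  shows "realizes_orders t b n"
  unfolding realizes_orders_def
proof (intro allI impI)
  fix \<nu> :: "3 \<Rightarrow> int" assume \<nu>: "(\<forall>j. \<nu> j \<ge> 0) \<and> (\<Sum>j\<in>UNIV. \<nu> j) = int n"
  have "\<exists>k. \<nu> k = 0"
  proof (rule ccontr)
    assume "\<not> ?thesis"
    then have "\<nu> j \<ge> 1" for j using \<nu> by (smt (verit))
    from this[of 1] this[of 2] this[of 3] show False using \<nu> assms(1) by (simp add: sum_3)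
  qed
  then show "\<exists>\<rho>. (\<forall>j. \<rho>$j > 0) \<and> torus_order (ppoly t b n) \<rho> \<nu>"
    using boundary_order_realized[OF assms(2)] \<nu> by blast
qed

lemma realizes_orders_cong:
  "(\<And>j. j \<le> n \<Longrightarrow> j mod 3 = n mod 3 \<Longrightarrow> b j = b' j) \<Longrightarrow> realizes_orders t b n \<longleftrightarrow> realizes_orders t b' n"
  unfolding realizes_orders_def using ppoly_cong[of n b b' t] by simp

text \<open>A cutoff obtained by choice may depend on all of \<open>b\<close>. It is therefore
  evaluated at a truncated sequence, which retains precisely the earlier coefficients entering the
  recursion.\<close>

lemma threshold_exists:
  obtains B :: "nat \<Rightarrow> (nat \<Rightarrow> real) \<Rightarrow> real" where "\<And>n b. B n b > 0"
    "\<And>n b b'. (\<And>j. j < n \<Longrightarrow> j mod 3 = n mod 3 \<Longrightarrow> b j = b' j) \<Longrightarrow> B n b = B n b'"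
    "\<And>n b. \<lbrakk>realizes_orders t b n; reciprocal t (n + 3); b (n + 3) > B (n + 3) b\<rbrakk> \<Longrightarrow> realizes_orders t b (n + 3)"
proof -
  define truncate :: "nat \<Rightarrow> (nat \<Rightarrow> real) \<Rightarrow> nat \<Rightarrow> real"
    where "truncate n b j = (if j < n \<and> j mod 3 = n mod 3 then b j else 0)" for n b j
  \<comment> \<open>\<open>C n b X\<close> says that \<open>X\<close> is an admissible threshold.
    Outside the inductive situation any positive number is admissible, so that a total choice
    exists.\<close>
  define C where "C n b X \<longleftrightarrow> X > 0 \<and>
    (3 \<le> n \<and> realizes_orders t b (n - 3) \<and> reciprocal t n \<longrightarrow> (\<forall>c>X. realizes_orders t (b(n := c)) n))" for n b X
  have "\<exists>X. C n b X" for n b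
  proof (cases "3 \<le> n \<and> realizes_orders t b (n - 3) \<and> reciprocal t n")
    case True
    then have "\<forall>\<^sub>F c in at_top. realizes_orders t (b(n := c)) n"
      using realizes_orders_step[of t b "n - 3"] by simp
    then obtain X where "\<And>c. c > X \<Longrightarrow> realizes_orders t (b(n := c)) n"
      unfolding eventually_at_top_dense by blast
    then have "C n b (max 1 X)" by (auto simp: C_def)
    then show ?thesis by blast
  next
    case False
    then have "C n b 1" by (auto simp: C_def)
    then show ?thesis by blast
  qed
  then obtain X where X: "\<And>n b. C n b (X n b)" by metis
  show thesis
  proof (rule that[of "\<lambda>n b. X n (truncate n b)"])
    show "X n (truncate n b) > 0" for n b using X by (auto simp: C_def)
    show "X n (truncate n b) = X n (truncate n b')"
      if "\<And>j. j < n \<Longrightarrow> j mod 3 = n mod 3 \<Longrightarrow> b j = b' j" for n b b'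
    proof -
      have "truncate n b = truncate n b'" using that by (auto simp: truncate_def fun_eq_iff)
      then show ?thesis by simp
    qed
    fix n b assume *: "realizes_orders t b n" "reciprocal t (n + 3)" "b (n + 3) > X (n + 3) (truncate (n + 3) b)"
    let ?b = "truncate (n + 3) b"
    have "realizes_orders t ?b n" using *(1) by (subst realizes_orders_cong[of n _ b]) (auto simp: truncate_def)
    then have "realizes_orders t (?b(n + 3 := b (n + 3))) (n + 3)"
      using X[of "n + 3" ?b] * by (simp add: C_def)
    then show "realizes_orders t b (n + 3)"
      by (subst realizes_orders_cong[of "n + 3" b "?b(n + 3 := b (n + 3))"]) (auto simp: truncate_def)
  qed
qed

text \<open>The threshold takes the whole sequence \<open>b\<close> as an argument; the clause
  comparing \<open>b\<close> and \<open>b'\<close> expresses that only earlier coefficients of the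
  same residue class matter, so \<open>B\<close> can be fixed before \<open>b\<close>.\<close>

theorem theorem2p1:
  fixes d :: nat and t :: "nat \<Rightarrow> nat \<Rightarrow> real"
  assumes "d \<ge> 1"
    and "\<forall>d'. d' \<le> d \<and> d' mod 3 = d mod 3 \<longrightarrow>
           (\<forall>i\<in>{1..d'}. t d' i > 0 \<and> t d' (d' - i + 1) = 1 / t d' i)
         \<and> inj_on (t d') {1..d'}
         \<and> (d' \<ge> 3 \<longrightarrow> t d' ` {1..d'} \<inter> t (d' - 3) ` {1..d' - 3} = {})"
  shows "\<exists>B :: nat \<Rightarrow> (nat \<Rightarrow> real) \<Rightarrow> real.
           (\<forall>d' b. B d' b > 0)
         \<and> (\<forall>d' b b'. (\<forall>j<d'. j mod 3 = d' mod 3 \<longrightarrow> b j = b' j) \<longrightarrow> B d' b = B d' b')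
         \<and> (\<forall>b. (\<forall>d'. 3 \<le> d' \<and> d' \<le> d \<and> d' mod 3 = d mod 3 \<longrightarrow> b d' > B d' b) \<longrightarrow>
               (let S = momentF ` curve (ppoly t b d) in
                  finite (holes S) \<and> card (holes S) = (d - 1) * (d - 2) div 2
                \<and> (\<forall>k. finite (S \<inter> simplex2_edge k) \<and> card (S \<inter> simplex2_edge k) = d)))"
proof -
  have t: "reciprocal t n" if "n \<le> d" "n mod 3 = d mod 3" for n
    using assms(2) that by (simp add: reciprocal_def)
  obtain B :: "nat \<Rightarrow> (nat \<Rightarrow> real) \<Rightarrow> real" where B: "\<And>n b. B n b > 0"
    "\<And>n b b'. (\<And>j. j < n \<Longrightarrow> j mod 3 = n mod 3 \<Longrightarrow> b j = b' j) \<Longrightarrow> B n b = B n b'"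
    "\<And>n b. \<lbrakk>realizes_orders t b n; reciprocal t (n + 3); b (n + 3) > B (n + 3) b\<rbrakk> \<Longrightarrow> realizes_orders t b (n + 3)"
    using threshold_exists[of t] by metis
  have main: "let S = momentF ` curve (ppoly t b d) in
                  finite (holes S) \<and> card (holes S) = (d - 1) * (d - 2) div 2
                \<and> (\<forall>k. finite (S \<inter> simplex2_edge k) \<and> card (S \<inter> simplex2_edge k) = d)"
    if b: "\<forall>d'. 3 \<le> d' \<and> d' \<le> d \<and> d' mod 3 = d mod 3 \<longrightarrow> b d' > B d' b" for b
  proof -
    have "n \<le> d \<Longrightarrow> n mod 3 = d mod 3 \<Longrightarrow> realizes_orders t b n" for n
    proof (induction n rule: step_3_induct)
      case (less n)
      then show ?case using realizes_orders_less_3 t by blast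
    next
      case (step n)
      then show ?case using b by (intro B(3) t) auto
    qed
    then have real: "realizes_orders t b d" by blast
    interpret plane_curve "ppoly t b d" d by (intro plane_curve_ppoly t) auto
    let ?I = "{n :: 3 \<Rightarrow> int. (\<forall>j. n j \<ge> 1) \<and> (\<Sum>j\<in>UNIV. n j) = int d}"
    have "\<exists>\<rho>. (\<forall>j. \<rho>$j > 0) \<and> torus_order (ppoly t b d) \<rho> n"
      if "\<And>j. n j \<ge> 1" "(\<Sum>j\<in>UNIV. n j) = int d" for n
    proof -
      have "\<forall>j. n j \<ge> 0" using that(1) by (metis order_trans zero_le_one)
      then show ?thesis using real that(2) unfolding realizes_orders_def by blast
    qed
    from bij_betw_positive_orders_holes[OF this] obtain G where "bij_betw G ?I (holes (momentF ` curve (ppoly t b d)))"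
      by blast
    then have "finite (holes (momentF ` curve (ppoly t b d)))"
      "card (holes (momentF ` curve (ppoly t b d))) = (d - 1) * (d - 2) div 2"
      using card_positive_triples[of d] bij_betw_finite[of G ?I] bij_betw_same_card[of G ?I] by auto
    then show ?thesis using ppoly_edge_points[OF t[OF order_refl refl], of b] by (simp add: Let_def)
  qed
  show ?thesis
    using B(1) main by (intro exI[of _ B] conjI allI impI) (auto intro: B(2))
qed

end
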